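(* Assume that the delay functions are $\tau_e(\theta_e,f_e)=f_e/\alpha_e+\theta_e$ with $\alpha_e>0$ for every link $e\in\mathcal E$; that there is a single origin-destination pair $(o,d)$, with unit throughput, and the link-path incidence matrix $A\in\{0,1\}^{\mathcal E\times\Gamma}$ is injective; and that the system-optimum path flow satisfies $z^*_\gamma(\theta)>0$ for every $\gamma\in\Gamma$ and every $\theta\in\operatorname{supp}(\Theta)$. Let $\mathbf b=A'\Theta$ and $M=(2A'[\alpha]^{-1}A)^{-1}\in\mathbb R^{\Gamma\times\Gamma}$, and for $i,\gamma\in\Gamma$ let $$W_i=\frac{\sum_{j\in\Gamma}M_{ij}}{\mathbf 1'M\mathbf 1},\qquad V_{i\gamma}=\frac{\sum_{j,k\in\Gamma}\big(M_{j\gamma}M_{ik}-M_{jk}M_{i\gamma}\big)}{\mathbf 1'M\mathbf 1}.$$ Then the direct signaling rule $\pi^*=z^*$ is an optimal rule and achieves the system-optimum cost, $C(f^{\pi^*})=C(f^* )$, if and only if $$\mathbb E\Big[(\mathbf b_i-\mathbf b_j)\Big(W_i+\sum_{\gamma\in\Gamma}V_{i\gamma}(\mathbf b_\gamma-\mathbf b_i)\Big)\Big]\le 0\qquad\text{for every two paths } i,j\in\Gamma.$$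
   Context: Network. $\mathcal G=(\mathcal V,\mathcal E,\sigma,\xi)$ is a finite directed multigraph with node set $\mathcal V$, link set $\mathcal E$, tail map $\sigma$ and head map $\xi$, without self-loops; $o\ne d$ are two nodes. An $(o,d)$-path is a tuple of links $(e_1,\dots,e_l)$, $l\ge1$, with $\sigma(e_1)=o$, $\xi(e_l)=d$, $\xi(e_i)=\sigma(e_{i+1})$ for $1\le i<l$, and $\sigma(e_i)\ne\sigma(e_j)$ for $i\ne j$. $\Gamma$ is the (finite, nonempty) set of $(o,d)$-paths, and $A_{e\gamma}=1$ if link $e$ belongs to path $\gamma$, $A_{e\gamma}=0$ otherwise. A unit mass of users travels from $o$ to $d$. Let $\mathcal Z=\{z\in\mathbb R_+^\Gamma:\mathbf 1'z=1\}$ and $\mathcal F=\{Az:z\in\mathcal Z\}$. For a vector $\alpha$, $[\alpha]$ is the diagonal matrix with diagonal $\alpha$; $'$ denotes transpose; $\mathbf 1$ is the all-ones vector. State, costs, optimum. The network state $\Theta$ is a random vector in $\mathbb R_+^{\mathcal E}$ with law denoted $\mathbb P$, whose entries have finite first and second moments; $\operatorname{supp}(\Theta)$ is the support of its law. Path costs are $c_\gamma(\theta,f)=\sum_eA_{e\gamma}\tau_e(\theta_e,f_e)$. The cost of a network flow $f:\mathbb R_+^{\mathcal E}\to\mathcal F$ is $C(f)=\mathbb E\big[\sum_ef_e(\Theta)\tau_e(\Theta_e,f_e(\Theta))\big]$. The system-optimum flow is $f^*(\theta)=\arg\min_{x\in\mathcal F}\sum_ex_e\tau_e(\theta_e,x_e)$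 (unique), so $C(f^* )=\min_fC(f)$. Since $A$ is injective there is a unique $z^*:\mathbb R_+^{\mathcal E}\to\mathcal Z$ with $f^*=Az^*$, the system-optimum path flow. Injectivity of $A$ also makes $M$ well defined and positive definite. Signaling rules. For a finite message set $\mathcal M$, a signaling rule is a measurable map $\pi:\mathbb R_+^{\mathcal E}\to\mathbb R_+^{\mathcal M}$ with $\sum_m\pi_m(\theta)=1$ for all $\theta$ ($\pi_m(\theta)$ is the fraction of users receiving message $m$ when $\Theta=\theta$). For $y\in\mathbb R_+^{\Gamma\times\mathcal M}$ with $\sum_\gamma y_{\gamma m}=1$ for every $m$, let $f^{\pi,y}(\theta)=Ay\pi(\theta)$. $f^{\pi,y}$ is a Bayesian Wardrop equilibrium (BWE) for $\pi$ if, whenever $y_{im}>0$, $\int\big(c_i(\theta,f^{\pi,y}(\theta))-c_j(\theta,f^{\pi,y}(\theta))\big)\pi_m(\theta)\,d\mathbb P(\theta)\le0$ for every $j\in\Gamma$. Every rule $\pi$ has a BWE, unique up to $\mathbb P$-null sets of $\theta$, denoted $f^\pi$; $C(f^\pi)$ is the cost of the rule. A rule is optimal if it minimizes $C(f^\pi)$ over all finite message sets $\mathcal M$ and all rules with message set $\mathcal M$. $z^*$ is regarded as a signaling rule with message set $\mathcal M=\Gamma$ (messages are path recommendations). *)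

theory Defs
  imports "HOL-Probability.Probability"
begin

section \<open>Network and flows\<close>

text \<open>
  Links are the elements of a finite type, with tail map \<open>\<sigma>\<close> and head map \<open>\<xi>\<close>. Only the
  tails of a path have to be distinct, so an intermediate link may end in the destination.
\<close>

definition od_paths :: "('e \<Rightarrow> 'v) \<Rightarrow> ('e \<Rightarrow> 'v) \<Rightarrow> 'v \<Rightarrow> 'v \<Rightarrow> 'e list set" where
  "od_paths \<sigma> \<xi> orig dest = {es. es \<noteq> [] \<and> \<sigma> (hd es) = orig \<and> \<xi> (last es) = dest
     \<and> (\<forall>i. Suc i < length es \<longrightarrow> \<xi> (es ! i) = \<sigma> (es ! Suc i))
     \<and> (\<forall>i<length es. \<forall>j<length es. i \<noteq> j \<longrightarrow> \<sigma> (es ! i) \<noteq> \<sigma> (es ! j))}"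

text \<open>
  The set of paths is enumerated bijectively by a finite type \<open>'p\<close>, so that vectors and matrices
  indexed by paths have the types of the library. This is an enumeration of the whole path set.
\<close>

definition enumerates_paths ::
    "('p::finite \<Rightarrow> 'e list) \<Rightarrow> ('e \<Rightarrow> 'v) \<Rightarrow> ('e \<Rightarrow> 'v) \<Rightarrow> 'v \<Rightarrow> 'v \<Rightarrow> bool" where
  "enumerates_paths route \<sigma> \<xi> orig dest \<longleftrightarrow> bij_betw route UNIV (od_paths \<sigma> \<xi> orig dest)"

definition incidence :: "('p::finite \<Rightarrow> 'e::finite list) \<Rightarrow> real^'p^'e" where
  "incidence route = (\<chi> e \<gamma>. if e \<in> set (route \<gamma>) then 1 else 0)"

definition path_flows :: "(real^'p::finite) set" where
  "path_flows = {z. (\<forall>\<gamma>. 0 \<le> z $ \<gamma>) \<and> (\<Sum>\<gamma>\<in>UNIV. z $ \<gamma>) = 1}"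

definition link_flows :: "real^'p::finite^'e::finite \<Rightarrow> (real^'e) set" where
  "link_flows A = (\<lambda>z. A *v z) ` path_flows"

section \<open>State, costs and system optimum\<close>

definition orthant :: "(real^'e::finite) set" where
  "orthant = {\<theta>. \<forall>e. 0 \<le> \<theta> $ e}"

abbreviation orthant_borel :: "(real^'e::finite) measure" where
  "orthant_borel \<equiv> restrict_space borel orthant"

text \<open>
  The law is a measure on the orthant itself, so that integrating a signaling rule against it
  only needs measurability of the rule on the orthant.
\<close>

definition state_law :: "'w measure \<Rightarrow> ('w \<Rightarrow> real^'e::finite) \<Rightarrow> (real^'e) measure" where
  "state_law \<Omega> \<Theta> = distr \<Omega> orthant_borel \<Theta>"

definition law_support :: "'a::topological_space measure \<Rightarrow> 'a set" where
  "law_support P = {\<theta> \<in> space P. \<forall>U. open U \<and> \<theta> \<in> U \<longrightarrow> emeasure P (U \<inter> space P) > 0}"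

definition affine_delay :: "real^'e::finite \<Rightarrow> 'e \<Rightarrow> real \<Rightarrow> real \<Rightarrow> real" where
  "affine_delay \<alpha> e t x = x / \<alpha> $ e + t"

definition path_cost ::
    "real^'p::finite^'e::finite \<Rightarrow> ('e \<Rightarrow> real \<Rightarrow> real \<Rightarrow> real) \<Rightarrow> 'p \<Rightarrow> real^'e \<Rightarrow> real^'e \<Rightarrow> real" where
  "path_cost A \<tau> \<gamma> \<theta> x = (\<Sum>e\<in>UNIV. A $ e $ \<gamma> * \<tau> e (\<theta> $ e) (x $ e))"

definition total_delay ::
    "('e::finite \<Rightarrow> real \<Rightarrow> real \<Rightarrow> real) \<Rightarrow> real^'e \<Rightarrow> real^'e \<Rightarrow> real" where
  "total_delay \<tau> \<theta> x = (\<Sum>e\<in>UNIV. x $ e * \<tau> e (\<theta> $ e) (x $ e))"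

definition flow_cost :: "'w measure \<Rightarrow> ('w \<Rightarrow> real^'e::finite) \<Rightarrow>
    ('e \<Rightarrow> real \<Rightarrow> real \<Rightarrow> real) \<Rightarrow> (real^'e \<Rightarrow> real^'e) \<Rightarrow> real" where
  "flow_cost \<Omega> \<Theta> \<tau> f = prob_space.expectation \<Omega> (\<lambda>\<omega>. total_delay \<tau> (\<Theta> \<omega>) (f (\<Theta> \<omega>)))"

definition optimum_flow :: "real^'p::finite^'e::finite \<Rightarrow>
    ('e \<Rightarrow> real \<Rightarrow> real \<Rightarrow> real) \<Rightarrow> real^'e \<Rightarrow> real^'e" where
  "optimum_flow A \<tau> \<theta> = arg_min_on (total_delay \<tau> \<theta>) (link_flows A)"

definition optimum_path_flow :: "real^'p::finite^'e::finite \<Rightarrow>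
    ('e \<Rightarrow> real \<Rightarrow> real \<Rightarrow> real) \<Rightarrow> real^'e \<Rightarrow> real^'p" where
  "optimum_path_flow A \<tau> \<theta> = (THE z. z \<in> path_flows \<and> optimum_flow A \<tau> \<theta> = A *v z)"

section \<open>Signaling rules and Bayesian Wardrop equilibria\<close>

definition signaling_rule :: "'m set \<Rightarrow> (real^'e::finite \<Rightarrow> 'm \<Rightarrow> real) \<Rightarrow> bool" where
  "signaling_rule Ms \<pi> \<longleftrightarrow> finite Ms
     \<and> (\<forall>m\<in>Ms. (\<lambda>\<theta>. \<pi> \<theta> m) \<in> borel_measurable orthant_borel)
     \<and> (\<forall>\<theta>\<in>orthant. (\<forall>m\<in>Ms. 0 \<le> \<pi> \<theta> m) \<and> (\<Sum>m\<in>Ms. \<pi> \<theta> m) = 1)"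

definition message_response :: "'m set \<Rightarrow> ('p::finite \<Rightarrow> 'm \<Rightarrow> real) \<Rightarrow> bool" where
  "message_response Ms y \<longleftrightarrow>
     (\<forall>m\<in>Ms. (\<forall>\<gamma>. 0 \<le> y \<gamma> m) \<and> (\<Sum>\<gamma>\<in>UNIV. y \<gamma> m) = 1)"

definition response_flow :: "real^'p::finite^'e::finite \<Rightarrow> 'm set \<Rightarrow>
    (real^'e \<Rightarrow> 'm \<Rightarrow> real) \<Rightarrow> ('p \<Rightarrow> 'm \<Rightarrow> real) \<Rightarrow> real^'e \<Rightarrow> real^'e" where
  "response_flow A Ms \<pi> y \<theta> = A *v (\<chi> \<gamma>. \<Sum>m\<in>Ms. y \<gamma> m * \<pi> \<theta> m)"

definition is_BWE :: "(real^'e) measure \<Rightarrow> real^'p::finite^'e::finite \<Rightarrow>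
    ('e \<Rightarrow> real \<Rightarrow> real \<Rightarrow> real) \<Rightarrow> 'm set \<Rightarrow> (real^'e \<Rightarrow> 'm \<Rightarrow> real) \<Rightarrow>
    (real^'e \<Rightarrow> real^'e) \<Rightarrow> bool" where
  "is_BWE P A \<tau> Ms \<pi> f \<longleftrightarrow> (\<exists>y. message_response Ms y \<and> f = response_flow A Ms \<pi> y
     \<and> (\<forall>i. \<forall>m\<in>Ms. y i m > 0 \<longrightarrow>
          (\<forall>j. (\<integral>\<theta>. (path_cost A \<tau> i \<theta> (f \<theta>) - path_cost A \<tau> j \<theta> (f \<theta>)) * \<pi> \<theta> m \<partial>P) \<le> 0)))"

text \<open>
  For the delays considered here, equilibria exist and are unique up to null sets of states, so
  the cost of the equilibrium flow does not depend on the choice.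
\<close>

definition BWE_flow :: "(real^'e) measure \<Rightarrow> real^'p::finite^'e::finite \<Rightarrow>
    ('e \<Rightarrow> real \<Rightarrow> real \<Rightarrow> real) \<Rightarrow> 'm set \<Rightarrow> (real^'e \<Rightarrow> 'm \<Rightarrow> real) \<Rightarrow> real^'e \<Rightarrow> real^'e" where
  "BWE_flow P A \<tau> Ms \<pi> = (SOME f. is_BWE P A \<tau> Ms \<pi> f)"

definition rule_cost :: "'w measure \<Rightarrow> ('w \<Rightarrow> real^'e) \<Rightarrow> real^'p::finite^'e::finite \<Rightarrow>
    ('e \<Rightarrow> real \<Rightarrow> real \<Rightarrow> real) \<Rightarrow> 'm set \<Rightarrow> (real^'e \<Rightarrow> 'm \<Rightarrow> real) \<Rightarrow> real" where
  "rule_cost \<Omega> \<Theta> A \<tau> Ms \<pi> = flow_cost \<Omega> \<Theta> \<tau> (BWE_flow (state_law \<Omega> \<Theta>) A \<tau> Ms \<pi>)"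

text \<open>
  The competing rules use arbitrary finite sets of natural numbers as message sets. Every finite
  message set is in bijection with one of these, and relabelling messages does not change the
  equilibria.
\<close>

definition optimal_rule :: "'w measure \<Rightarrow> ('w \<Rightarrow> real^'e) \<Rightarrow> real^'p::finite^'e::finite \<Rightarrow>
    ('e \<Rightarrow> real \<Rightarrow> real \<Rightarrow> real) \<Rightarrow> 'm set \<Rightarrow> (real^'e \<Rightarrow> 'm \<Rightarrow> real) \<Rightarrow> bool" where
  "optimal_rule \<Omega> \<Theta> A \<tau> Ms \<pi> \<longleftrightarrow> signaling_rule Ms \<pi>
     \<and> (\<forall>(Ms' :: nat set) \<pi>'. signaling_rule Ms' \<pi>' \<longrightarrow>
          rule_cost \<Omega> \<Theta> A \<tau> Ms \<pi> \<le> rule_cost \<Omega> \<Theta> A \<tau> Ms' \<pi>')"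

definition direct_optimum_rule :: "real^'p::finite^'e::finite \<Rightarrow>
    ('e \<Rightarrow> real \<Rightarrow> real \<Rightarrow> real) \<Rightarrow> real^'e \<Rightarrow> 'p \<Rightarrow> real" where
  "direct_optimum_rule A \<tau> \<theta> m = optimum_path_flow A \<tau> \<theta> $ m"

section \<open>Matrices in the optimality condition\<close>

definition diag_matrix :: "real^'n::finite \<Rightarrow> real^'n^'n" where
  "diag_matrix v = (\<chi> i j. if i = j then v $ i else 0)"

definition M_matrix :: "real^'p::finite^'e::finite \<Rightarrow> real^'e \<Rightarrow> real^'p^'p" where
  "M_matrix A \<alpha> = matrix_inv (2 *\<^sub>R (transpose A ** matrix_inv (diag_matrix \<alpha>) ** A))"

definition W_coef :: "real^'p::finite^'p \<Rightarrow> 'p \<Rightarrow> real" where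
  "W_coef M i = (\<Sum>j\<in>UNIV. M $ i $ j) / (\<Sum>j\<in>UNIV. \<Sum>k\<in>UNIV. M $ j $ k)"

definition V_coef :: "real^'p::finite^'p \<Rightarrow> 'p \<Rightarrow> 'p \<Rightarrow> real" where
  "V_coef M i \<gamma> = (\<Sum>j\<in>UNIV. \<Sum>k\<in>UNIV. (M $ j $ \<gamma> * M $ i $ k - M $ j $ k * M $ i $ \<gamma>))
     / (\<Sum>j\<in>UNIV. \<Sum>k\<in>UNIV. M $ j $ k)"

end

theory Submission
  imports Defs
begin

text \<open>
  At a state where the optimal path flow \<open>z\<close> is interior, all paths have the same marginal cost
  \<open>\<lambda>\<close>, that is, \<open>M\<^sup>-\<^sup>1 z + b = \<lambda> 1\<close>. Solving for \<open>z\<close> gives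
  \<open>z\<^sub>i = W\<^sub>i + (\<Sum>\<gamma>. V\<^sub>i\<^sub>\<gamma> (b\<^sub>\<gamma> - b\<^sub>i))\<close>, and the path costs are \<open>(\<lambda> + b\<^sub>i) / 2\<close>. The stated
  inequality is therefore, up to a factor 2, the condition that following the recommendations of
  \<open>z\<close> is an equilibrium. Equilibrium flows exist as minimisers of a convex potential and are
  unique almost everywhere by monotonicity of the delays, so obedience makes the rule attain the
  system optimum. Conversely, if the rule attains this cost then its equilibrium flow is almost
  surely the optimum, and weighting the equilibrium conditions of the messages by the response
  yields obedience.
\<close>

section \<open>Affine delays\<close>

definition link_delay :: "real^'e::finite \<Rightarrow> real^'e \<Rightarrow> real^'e \<Rightarrow> real^'e" where
  "link_delay \<alpha> \<theta> x = (\<chi> e. x $ e / \<alpha> $ e + \<theta> $ e)"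

text \<open>Gradient in the flow of \<open>total_delay (affine_delay \<alpha>) \<theta>\<close>; the
  derivative doubles only the part of the delay that depends on the flow.\<close>

definition marginal_cost :: "real^'e::finite \<Rightarrow> real^'e \<Rightarrow> real^'e \<Rightarrow> real^'e" where
  "marginal_cost \<alpha> \<theta> x = (\<chi> e. 2 * x $ e / \<alpha> $ e + \<theta> $ e)"

text \<open>The quadratic part of the total delay. For positive capacities it is a squared weighted
  Euclidean norm.\<close>

definition congestion :: "real^'e::finite \<Rightarrow> real^'e \<Rightarrow> real" where
  "congestion \<alpha> x = (\<Sum>e\<in>UNIV. (x $ e)\<^sup>2 / \<alpha> $ e)"

lemma total_delay_affine: "total_delay (affine_delay \<alpha>) \<theta> x = x \<bullet> link_delay \<alpha> \<theta> x"
  by (simp add: total_delay_def affine_delay_def link_delay_def inner_vec_def)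

text \<open>The total delay is a quadratic polynomial in the flow, so its second-order Taylor
  expansion is exact.\<close>

lemma total_delay_shift:
  "total_delay (affine_delay \<alpha>) \<theta> (x + t *\<^sub>R \<delta>) =
     total_delay (affine_delay \<alpha>) \<theta> x + t * (\<delta> \<bullet> marginal_cost \<alpha> \<theta> x) + t\<^sup>2 * congestion \<alpha> \<delta>"
  unfolding total_delay_def affine_delay_def marginal_cost_def congestion_def inner_vec_def
    sum_distrib_left sum.distrib[symmetric]
  by (rule sum.cong) (auto simp: algebra_simps power2_eq_square add_divide_distrib)

lemma total_delay_expand:
  "total_delay (affine_delay \<alpha>) \<theta> y =
     total_delay (affine_delay \<alpha>) \<theta> x + (y - x) \<bullet> marginal_cost \<alpha> \<theta> x + congestion \<alpha> (y - x)"
  using total_delay_shift[of \<alpha> \<theta> x 1 "y - x"] by simp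

text \<open>
  Doubling the capacities turns the social cost into the Beckmann potential: its gradient is the
  vector of link delays.
\<close>

lemma marginal_cost_double: "marginal_cost (2 *\<^sub>R \<alpha>) \<theta> x = link_delay \<alpha> \<theta> x"
  by (simp add: marginal_cost_def link_delay_def)

text \<open>The state terms cancel. For positive capacities this is strong monotonicity of the
  delays, the source of uniqueness of equilibrium flows.\<close>

lemma link_delay_diff:
  "(x - y) \<bullet> (link_delay \<alpha> \<theta> x - link_delay \<alpha> \<theta> y) = congestion \<alpha> (x - y)"
  unfolding inner_vec_def link_delay_def congestion_def
  by (rule sum.cong) (auto simp: power2_eq_square algebra_simps diff_divide_distrib add_divide_distrib)

text \<open>With two different states a linear term in their difference survives; it controls how
  fast the optimum moves with the state.\<close>

lemma marginal_cost_diff: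
  "(x - y) \<bullet> (marginal_cost \<alpha> \<theta> x - marginal_cost \<alpha> \<theta>' y)
     = 2 * congestion \<alpha> (x - y) + (x - y) \<bullet> (\<theta> - \<theta>')"
  unfolding inner_vec_def marginal_cost_def congestion_def sum_distrib_left sum.distrib[symmetric]
  by (rule sum.cong) (auto simp: power2_eq_square algebra_simps diff_divide_distrib add_divide_distrib)

lemma path_cost_affine:
  "path_cost A (affine_delay \<alpha>) \<gamma> \<theta> x = (transpose A *v link_delay \<alpha> \<theta> x) $ \<gamma>"
  by (simp add: path_cost_def affine_delay_def link_delay_def matrix_vector_mult_def transpose_def)

lemma inner_matrix_vector: "(A *v z) \<bullet> d = z \<bullet> (transpose A *v d)" for A :: "real^'p::finite^'e::finite"
  by (metis dot_lmul_matrix inner_commute transpose_matrix_vector)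

lemma inner_path_cost:
  "(A *v z) \<bullet> link_delay \<alpha> \<theta> x = (\<Sum>\<gamma>\<in>UNIV. z $ \<gamma> * path_cost A (affine_delay \<alpha>) \<gamma> \<theta> x)"
  unfolding inner_matrix_vector by (simp add: path_cost_affine inner_vec_def)

text \<open>First-order optimality in one direction: dividing by \<open>t\<close> and letting
  \<open>t\<close> tend to 0 leaves the slope \<open>a\<close>.\<close>

lemma slope_nonneg:
  fixes a c :: real
  assumes "\<And>t. 0 < t \<Longrightarrow> t \<le> 1 \<Longrightarrow> 0 \<le> t * a + t\<^sup>2 * c"
  shows "0 \<le> a"
proof (rule ccontr)
  assume "\<not> 0 \<le> a"
  then have a: "a < 0" by simp
  \<comment> \<open>A step so short that the quadratic term is at most half the linear one. The
    summand 1 keeps the denominator positive when \<open>c = 0\<close>.\<close>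
  define t where "t = min 1 (- a / (2 * (\<bar>c\<bar> + 1)))"
  have t: "0 < t" "t \<le> 1" using a by (auto simp: t_def divide_neg_pos add_nonneg_pos)
  have "t * \<bar>c\<bar> \<le> t * (\<bar>c\<bar> + 1)" using t by simp
  also have "\<dots> \<le> - a / (2 * (\<bar>c\<bar> + 1)) * (\<bar>c\<bar> + 1)"
    by (intro mult_right_mono) (auto simp: t_def)
  also have "\<dots> = - a / 2" by (simp add: field_simps add_pos_nonneg)
  finally have "t * c \<le> - a / 2" using t abs_ge_self[of c] by (smt (verit) mult_left_mono)
  then have "a + t * c < 0" using a by linarith
  then have "t * (a + t * c) < 0" using t by (simp add: mult_pos_neg)
  then show False using assms[OF t] by (simp add: algebra_simps power2_eq_square)
qed

section \<open>Feasible flows\<close>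

lemma axis_in_path_flows: "axis \<gamma> 1 \<in> path_flows"
  by (auto simp: path_flows_def axis_def)

lemma convex_path_flows: "convex (path_flows :: (real^'p::finite) set)"
  unfolding convex_def path_flows_def
  by (auto simp: sum.distrib sum_distrib_left[symmetric])

lemma compact_path_flows: "compact (path_flows :: (real^'p::finite) set)"
proof -
  have "path_flows = (\<Inter>\<gamma>. {z :: real^'p. 0 \<le> z $ \<gamma>}) \<inter> {z. (\<Sum>\<gamma>\<in>UNIV. z $ \<gamma>) = 1}"
    by (auto simp: path_flows_def)
  moreover have "closed \<dots>"
    by (intro closed_Int closed_INT ballI closed_Collect_le closed_Collect_eq continuous_intros)
  moreover have "bounded (path_flows :: (real^'p) set)"
  proof (rule boundedI)
    fix z :: "real^'p" assume z: "z \<in> path_flows"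
    have "norm z \<le> (\<Sum>\<gamma>\<in>UNIV. \<bar>z $ \<gamma>\<bar>)" by (rule norm_le_l1_cart)
    also have "\<dots> = 1" using z by (simp add: path_flows_def)
    finally show "norm z \<le> 1" .
  qed
  ultimately show ?thesis by (metis compact_eq_bounded_closed)
qed

lemma link_flows_nonempty: "link_flows A \<noteq> {}"
  using axis_in_path_flows by (auto simp: link_flows_def)

lemma convex_link_flows: "convex (link_flows A)"
  unfolding link_flows_def
  by (intro convex_linear_image convex_path_flows) (simp add: matrix_vector_mul_linear)

lemma compact_link_flows: "compact (link_flows A)"
  unfolding link_flows_def
  by (intro compact_continuous_image compact_path_flows continuous_intros)

lemma link_flows_bounded: "\<exists>K. \<forall>x\<in>link_flows A. \<forall>e. \<bar>x $ e\<bar> \<le> K"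
proof -
  obtain K where "\<forall>x\<in>link_flows A. norm x \<le> K"
    using compact_link_flows compact_imp_bounded bounded_iff by blast
  then show ?thesis by (meson component_le_norm_cart order_trans)
qed

section \<open>The system optimum\<close>

locale affine_network =
  fixes A :: "real^'p::finite^'e::finite" and \<alpha> :: "real^'e"
  assumes A_inj: "inj (\<lambda>z. A *v z)"
    and alpha_pos: "\<And>e. 0 < \<alpha> $ e"
begin

abbreviation "opt \<equiv> optimum_flow A (affine_delay \<alpha>)"
abbreviation "opt_path \<equiv> optimum_path_flow A (affine_delay \<alpha>)"

lemma congestion_nonneg: "0 \<le> congestion \<alpha> x"
  unfolding congestion_def using alpha_pos by (intro sum_nonneg divide_nonneg_pos) auto

lemma congestion_eq_0: "congestion \<alpha> x = 0 \<longleftrightarrow> x = 0"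
proof -
  have "congestion \<alpha> x = 0 \<longleftrightarrow> (\<forall>e\<in>UNIV. (x $ e)\<^sup>2 / \<alpha> $ e = 0)"
    unfolding congestion_def
    by (intro sum_nonneg_eq_0_iff divide_nonneg_pos alpha_pos) auto
  also have "\<dots> \<longleftrightarrow> x = 0"
    using alpha_pos by (auto simp: vec_eq_iff order_less_imp_not_eq2)
  finally show ?thesis .
qed

text \<open>\<open>arg_min_on\<close> is a Hilbert choice and carries information only once a
  minimiser exists; compactness of the feasible flows provides one.\<close>

lemma optimum_flow_min:
  shows optimum_flow_in: "opt \<theta> \<in> link_flows A"
    and optimum_flow_le: "y \<in> link_flows A \<Longrightarrow>
      total_delay (affine_delay \<alpha>) \<theta> (opt \<theta>) \<le> total_delay (affine_delay \<alpha>) \<theta> y"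
proof -
  let ?T = "total_delay (affine_delay \<alpha>) \<theta>"
  have "continuous_on (link_flows A) ?T"
    unfolding total_delay_def affine_delay_def using alpha_pos
    by (intro continuous_intros) (auto simp: less_imp_neq[symmetric])
  then obtain x where "x \<in> link_flows A" "\<forall>y\<in>link_flows A. ?T x \<le> ?T y"
    using continuous_attains_inf[OF compact_link_flows link_flows_nonempty] by blast
  then have "is_arg_min ?T (\<lambda>x. x \<in> link_flows A) x" by (auto simp: is_arg_min_linorder)
  then have "is_arg_min ?T (\<lambda>x. x \<in> link_flows A) (opt \<theta>)"
    unfolding optimum_flow_def arg_min_on_def arg_min_def by (rule someI)
  then show "opt \<theta> \<in> link_flows A" "y \<in> link_flows A \<Longrightarrow> ?T (opt \<theta>) \<le> ?T y"
    by (auto simp: is_arg_min_linorder)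
qed

text \<open>Convexity keeps the segment from the optimum to \<open>y\<close> feasible, so the cost
  cannot have a negative slope along it.\<close>

lemma optimum_flow_variational:
  assumes y: "y \<in> link_flows A"
  shows "0 \<le> (y - opt \<theta>) \<bullet> marginal_cost \<alpha> \<theta> (opt \<theta>)"
proof (rule slope_nonneg)
  fix t :: real assume t: "0 < t" "t \<le> 1"
  have "(1 - t) *\<^sub>R opt \<theta> + t *\<^sub>R y \<in> link_flows A"
    using t y optimum_flow_in convex_link_flows by (intro convexD) auto
  moreover have "(1 - t) *\<^sub>R opt \<theta> + t *\<^sub>R y = opt \<theta> + t *\<^sub>R (y - opt \<theta>)"
    by (simp add: algebra_simps)
  ultimately have "opt \<theta> + t *\<^sub>R (y - opt \<theta>) \<in> link_flows A" by simp
  from optimum_flow_le[OF this, of \<theta>]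
  show "0 \<le> t * ((y - opt \<theta>) \<bullet> marginal_cost \<alpha> \<theta> (opt \<theta>)) + t\<^sup>2 * congestion \<alpha> (y - opt \<theta>)"
    unfolding total_delay_shift by simp
qed

text \<open>In the exact expansion around the optimum the linear term is nonnegative. The excess
  cost therefore dominates the squared distance, which makes near-optimal flows close to the
  optimum.\<close>

lemma optimum_flow_gap:
  assumes "y \<in> link_flows A"
  shows "congestion \<alpha> (y - opt \<theta>) \<le>
    total_delay (affine_delay \<alpha>) \<theta> y - total_delay (affine_delay \<alpha>) \<theta> (opt \<theta>)"
  using optimum_flow_variational[OF assms, of \<theta>] total_delay_expand[of \<alpha> \<theta> y "opt \<theta>"] by simp

lemma optimum_path_flow_unique:
  assumes "z \<in> path_flows" "opt \<theta> = A *v z"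
  shows "opt_path \<theta> = z"
  unfolding optimum_path_flow_def using assms injD[OF A_inj] by (intro the_equality) auto

lemma optimum_path_flow:
  shows optimum_path_flow_in: "opt_path \<theta> \<in> path_flows"
    and optimum_flow_eq: "opt \<theta> = A *v opt_path \<theta>"
proof -
  obtain z where "z \<in> path_flows" "opt \<theta> = A *v z"
    using optimum_flow_in[of \<theta>] by (auto simp: link_flows_def)
  with optimum_path_flow_unique[OF this] show "opt_path \<theta> \<in> path_flows" "opt \<theta> = A *v opt_path \<theta>"
    by simp_all
qed

text \<open>Adding the variational inequalities at two states bounds the change of the optimum.\<close>

lemma optimum_flow_lipschitz:
  "\<exists>K. \<forall>\<theta> \<theta>'. norm (opt \<theta> - opt \<theta>') \<le> K * norm (\<theta> - \<theta>')"
proof -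
  \<comment> \<open>The largest capacity: it converts \<open>congestion \<alpha>\<close> into a
    bound on the Euclidean norm.\<close>
  define a where "a = Max (range (\<lambda>e. \<alpha> $ e))"
  have le_a: "\<alpha> $ e \<le> a" for e by (simp add: a_def)
  have a: "0 < a" using le_a[of undefined] alpha_pos[of undefined] by simp
  have "norm (opt \<theta> - opt \<theta>') \<le> a * norm (\<theta> - \<theta>')" for \<theta> \<theta>'
  proof -
    let ?d = "opt \<theta> - opt \<theta>'"
    have "(norm ?d)\<^sup>2 = (\<Sum>e\<in>UNIV. (?d $ e)\<^sup>2)"
      unfolding power2_norm_eq_inner inner_vec_def by (simp add: power2_eq_square)
    also have "\<dots> \<le> (\<Sum>e\<in>UNIV. a * ((?d $ e)\<^sup>2 / \<alpha> $ e))"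
    proof (rule sum_mono)
      fix e
      have "(?d $ e)\<^sup>2 * \<alpha> $ e \<le> (?d $ e)\<^sup>2 * a" by (intro mult_left_mono le_a) auto
      then show "(?d $ e)\<^sup>2 \<le> a * ((?d $ e)\<^sup>2 / \<alpha> $ e)"
        using alpha_pos[of e] by (simp add: field_simps)
    qed
    also have "\<dots> = a * congestion \<alpha> ?d" by (simp add: congestion_def sum_distrib_left)
    finally have 1: "(norm ?d)\<^sup>2 \<le> a * congestion \<alpha> ?d" .
    have "2 * congestion \<alpha> ?d + ?d \<bullet> (\<theta> - \<theta>') \<le> 0"
      unfolding marginal_cost_diff[symmetric]
      using optimum_flow_variational[OF optimum_flow_in, of \<theta> \<theta>']
        optimum_flow_variational[OF optimum_flow_in, of \<theta>' \<theta>]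
      by (simp add: inner_diff)
    moreover have "\<bar>?d \<bullet> (\<theta> - \<theta>')\<bar> \<le> norm ?d * norm (\<theta> - \<theta>')" by (rule Cauchy_Schwarz_ineq2)
    ultimately have "congestion \<alpha> ?d \<le> norm ?d * norm (\<theta> - \<theta>')"
      using congestion_nonneg[of ?d] by linarith
    with 1 a have "(norm ?d)\<^sup>2 \<le> a * (norm ?d * norm (\<theta> - \<theta>'))"
      by (smt (verit) mult_left_mono)
    then have "norm ?d * norm ?d \<le> norm ?d * (a * norm (\<theta> - \<theta>'))"
      by (simp add: power2_eq_square mult_ac)
    then show ?thesis
      by (cases "norm ?d = 0") (use a in \<open>simp_all add: mult_le_cancel_left\<close>)
  qed
  then show ?thesis by blast
qed

section \<open>Continuity of the optimum in the state\<close>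

lemma continuous_optimum_flow: "continuous_on UNIV opt"
proof -
  obtain K where K: "\<And>\<theta> \<theta>'. norm (opt \<theta> - opt \<theta>') \<le> K * norm (\<theta> - \<theta>')"
    using optimum_flow_lipschitz by blast
  \<comment> \<open>The absolute value supplies the nonnegative constant that
    \<open>lipschitz_on\<close> demands, since the sign of \<open>K\<close> is not recorded.\<close>
  have "norm (opt \<theta> - opt \<theta>') \<le> \<bar>K\<bar> * norm (\<theta> - \<theta>')" for \<theta> \<theta>'
    using K[of \<theta> \<theta>'] abs_ge_self[of K] by (meson mult_right_mono norm_ge_zero order_trans)
  then have "\<bar>K\<bar>-lipschitz_on UNIV opt"
    by (intro lipschitz_onI) (auto simp: dist_norm)
  then show ?thesis by (rule lipschitz_on_continuous_on)
qed

lemma continuous_optimum_path_flow: "continuous_on UNIV opt_path"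
proof -
  \<comment> \<open>A left inverse of \<open>A\<close> recovers the path flow linearly, hence
    continuously, from the link flow.\<close>
  obtain B :: "real^'e^'p" where B: "B ** A = mat 1"
    using A_inj matrix_left_invertible_injective[of A] by blast
  have "opt_path = (\<lambda>\<theta>. B *v opt \<theta>)"
    by (simp add: optimum_flow_eq matrix_vector_mul_assoc B)
  moreover have "continuous_on UNIV (\<lambda>\<theta>. B *v opt \<theta>)"
    by (intro continuous_intros linear_continuous_on_compose[OF continuous_optimum_flow]
        matrix_vector_mul_linear)
  ultimately show ?thesis by simp
qed

lemma signaling_rule_optimum: "signaling_rule UNIV (direct_optimum_rule A (affine_delay \<alpha>))"
  unfolding signaling_rule_def direct_optimum_rule_def
proof (intro conjI ballI)
  fix \<gamma> :: 'p
  have "continuous_on UNIV (\<lambda>\<theta>. opt_path \<theta> $ \<gamma>)"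
    by (intro continuous_intros continuous_optimum_path_flow)
  then show "(\<lambda>\<theta>. opt_path \<theta> $ \<gamma>) \<in> borel_measurable orthant_borel"
    by (intro measurable_restrict_space1 borel_measurable_continuous_onI)
qed (use optimum_path_flow_in in \<open>auto simp: path_flows_def\<close>)

section \<open>Closed form of an interior optimum\<close>

lemma interior_marginal_cost:
  assumes pos: "\<And>\<gamma>. 0 < opt_path \<theta> $ \<gamma>"
  shows "(transpose A *v marginal_cost \<alpha> \<theta> (opt \<theta>)) $ i
    = (transpose A *v marginal_cost \<alpha> \<theta> (opt \<theta>)) $ j"
proof -
  let ?z = "opt_path \<theta>" and ?g = "transpose A *v marginal_cost \<alpha> \<theta> (opt \<theta>)"
  have "?g $ i \<le> ?g $ j" for i j
  proof -
    \<comment> \<open>All mass on path \<open>i\<close> is moved to path \<open>j\<close>. This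
      stays feasible, and positivity of that mass allows it to be cancelled from the variational
      inequality.\<close>
    let ?w = "?z + (?z $ i) *\<^sub>R (axis j 1 - axis i 1)"
    have "?w \<in> path_flows"
      using optimum_path_flow_in[of \<theta>]
      by (auto simp: path_flows_def axis_def sum.distrib sum_subtractf sum_distrib_left[symmetric])
    then have "A *v ?w \<in> link_flows A" by (auto simp: link_flows_def)
    have "A *v ?w - opt \<theta> = A *v (?z $ i *\<^sub>R (axis j 1 - axis i 1))"
      unfolding optimum_flow_eq[of \<theta>] by (simp only: matrix_vector_right_distrib add_diff_cancel_left')
    with optimum_flow_variational[OF \<open>A *v ?w \<in> link_flows A\<close>, of \<theta>]
    have "0 \<le> (A *v (?z $ i *\<^sub>R (axis j 1 - axis i 1))) \<bullet> marginal_cost \<alpha> \<theta> (opt \<theta>)"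
      by simp
    also have "\<dots> = ?z $ i * (?g $ j - ?g $ i)"
      by (simp add: inner_matrix_vector inner_diff_left inner_axis')
    finally show ?thesis using pos[of i] by (simp add: zero_le_mult_iff)
  qed
  then show ?thesis by (meson order_antisym)
qed

text \<open>A path's marginal cost is twice its cost minus its free-flow cost. Marginal costs agree
  at an interior optimum, so costs differ by half the difference of free-flow costs.\<close>

lemma interior_path_cost_diff:
  assumes "\<And>\<gamma>. 0 < opt_path \<theta> $ \<gamma>"
  shows "path_cost A (affine_delay \<alpha>) i \<theta> (opt \<theta>) - path_cost A (affine_delay \<alpha>) j \<theta> (opt \<theta>)
    = ((transpose A *v \<theta>) $ i - (transpose A *v \<theta>) $ j) / 2"
proof -
  have "marginal_cost \<alpha> \<theta> x = 2 *\<^sub>R link_delay \<alpha> \<theta> x - \<theta>" for x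
    by (simp add: marginal_cost_def link_delay_def vec_eq_iff)
  then have "(transpose A *v marginal_cost \<alpha> \<theta> (opt \<theta>)) $ k
      = 2 * path_cost A (affine_delay \<alpha>) k \<theta> (opt \<theta>) - (transpose A *v \<theta>) $ k" for k
    by (simp add: path_cost_affine matrix_vector_mult_diff_distrib matrix_vector_mult_scaleR)
  with interior_marginal_cost[of \<theta> i j, OF assms] show ?thesis by simp
qed

text \<open>At state 0 the marginal cost is linear, and passing to paths gives exactly the matrix
  inverted in \<open>M_matrix\<close>. This identifies its quadratic form, from which definiteness
  follows.\<close>

lemma inner_marginal_cost_0:
  "z \<bullet> (transpose A *v marginal_cost \<alpha> 0 (A *v z)) = 2 * congestion \<alpha> (A *v z)"
proof -
  have "x \<bullet> marginal_cost \<alpha> 0 x = 2 * congestion \<alpha> x" for x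
    unfolding inner_vec_def marginal_cost_def congestion_def sum_distrib_left
    by (rule sum.cong) (auto simp: power2_eq_square)
  then show ?thesis by (simp only: inner_matrix_vector[symmetric])
qed

lemma M_matrix_inverse:
  shows M_matrix_left_inverse:
      "M_matrix A \<alpha> *v (transpose A *v marginal_cost \<alpha> 0 (A *v z)) = z"
    and M_matrix_right_inverse:
      "transpose A *v marginal_cost \<alpha> 0 (A *v (M_matrix A \<alpha> *v z)) = z"
proof -
  \<comment> \<open>\<open>matrix_inv\<close> is a choice; a one-sided inverse of a square matrix is
    two-sided and unique, which determines it. The index type is free because links and paths both
    need this fact.\<close>
  have inv: "matrix_inv X = Y" if "X ** Y = mat 1" for X Y :: "real^'n^'n"
  proof -
    have "Y ** X = mat 1" using that matrix_left_right_inverse by blast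
    with that have "X ** matrix_inv X = mat 1 \<and> matrix_inv X ** X = mat 1"
      unfolding matrix_inv_def by (intro someI_ex[of "\<lambda>B. X ** B = mat 1 \<and> B ** X = mat 1"]) blast
    then show ?thesis by (metis that matrix_mul_assoc matrix_mul_lid matrix_mul_rid)
  qed
  have diag: "diag_matrix v ** B = (\<chi> i j. v $ i * B $ i $ j)"
    "diag_matrix v *v x = (\<chi> i. v $ i * x $ i)" for v x :: "real^'e" and B :: "real^'e^'e"
    by (simp_all add: diag_matrix_def matrix_matrix_mult_def matrix_vector_mult_def
        if_distrib[of "\<lambda>x. x * _"] cong: if_cong)
  have "\<alpha> $ e \<noteq> 0" for e using alpha_pos[of e] by simp
  then have D: "matrix_inv (diag_matrix \<alpha>) = diag_matrix (\<chi> e. 1 / \<alpha> $ e)"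
    by (intro inv, unfold diag) (simp add: diag_matrix_def mat_def vec_eq_iff)
  define X where "X = 2 *\<^sub>R (transpose A ** matrix_inv (diag_matrix \<alpha>) ** A)"
  have X: "X *v z = transpose A *v marginal_cost \<alpha> 0 (A *v z)" for z
  proof -
    have "X *v z = transpose A *v (2 *\<^sub>R (matrix_inv (diag_matrix \<alpha>) *v (A *v z)))"
      by (simp add: X_def scaleR_matrix_vector_assoc[symmetric] matrix_vector_mul_assoc
          matrix_mul_assoc matrix_vector_mult_scaleR)
    also have "2 *\<^sub>R (matrix_inv (diag_matrix \<alpha>) *v x) = marginal_cost \<alpha> 0 x" for x
      by (simp add: D diag marginal_cost_def vec_eq_iff)
    finally show ?thesis .
  qed
  \<comment> \<open>Trivial kernel: a vanishing quadratic form forces \<open>A *v z = 0\<close>, and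
    \<open>A\<close> is injective.\<close>
  have "z = 0" if "X *v z = 0" for z
  proof -
    have "z \<bullet> (X *v z) = 2 * congestion \<alpha> (A *v z)" by (simp only: X inner_marginal_cost_0)
    then have "A *v z = 0" using that by (simp add: congestion_eq_0)
    then show "z = 0" using injD[OF A_inj, of z 0] by simp
  qed
  then obtain B where "B ** X = mat 1" using matrix_left_invertible_ker[of X] by blast
  then have "X ** B = mat 1" using matrix_left_right_inverse by blast
  then have "matrix_inv X ** X = mat 1" "X ** matrix_inv X = mat 1"
    using inv[of X B] matrix_left_right_inverse by blast+
  then show "M_matrix A \<alpha> *v (transpose A *v marginal_cost \<alpha> 0 (A *v z)) = z"
    "transpose A *v marginal_cost \<alpha> 0 (A *v (M_matrix A \<alpha> *v z)) = z"
    unfolding X[symmetric] M_matrix_def X_def[symmetric] by (simp_all add: matrix_vector_mul_assoc)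
qed

text \<open>Equal marginal costs \<open>l\<close> give \<open>M *v (l *\<^sub>R ?one - c)\<close>
  for the path flow; unit total mass then determines \<open>l\<close>.\<close>

lemma interior_optimum_path_flow:
  assumes pos: "\<And>\<gamma>. 0 < opt_path \<theta> $ \<gamma>"
  defines "M \<equiv> M_matrix A \<alpha>" and "c \<equiv> transpose A *v \<theta>"
  shows "opt_path \<theta> $ i = W_coef M i + (\<Sum>\<gamma>\<in>UNIV. V_coef M i \<gamma> * (c $ \<gamma> - c $ i))"
proof -
  let ?one = "(\<chi> k. 1) :: real^'p"
  define s where "s = (\<Sum>j\<in>UNIV. \<Sum>k\<in>UNIV. M $ j $ k)"
  obtain l where l: "\<And>k. (transpose A *v marginal_cost \<alpha> \<theta> (opt \<theta>)) $ k = l"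
    using interior_marginal_cost[of \<theta>, OF pos] by blast
  have "marginal_cost \<alpha> \<theta> (opt \<theta>) = marginal_cost \<alpha> 0 (opt \<theta>) + \<theta>"
    by (simp add: marginal_cost_def vec_eq_iff)
  then have "transpose A *v marginal_cost \<alpha> \<theta> (opt \<theta>)
      = transpose A *v marginal_cost \<alpha> 0 (opt \<theta>) + c"
    by (simp only: matrix_vector_right_distrib c_def)
  moreover have "transpose A *v marginal_cost \<alpha> \<theta> (opt \<theta>) = l *\<^sub>R ?one"
    using l by (simp add: vec_eq_iff)
  ultimately have "transpose A *v marginal_cost \<alpha> 0 (A *v opt_path \<theta>) = l *\<^sub>R ?one - c"
    by (metis eq_diff_eq optimum_flow_eq)
  then have z: "opt_path \<theta> = M *v (l *\<^sub>R ?one - c)"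
    using M_matrix_left_inverse[of "opt_path \<theta>"] by (simp add: M_def)
  have zi: "opt_path \<theta> $ i = l * (\<Sum>k\<in>UNIV. M $ i $ k) - (\<Sum>k\<in>UNIV. M $ i $ k * c $ k)" for i
    by (simp add: z matrix_vector_mult_def algebra_simps sum_subtractf sum_distrib_left)
  \<comment> \<open>Normalisation is the equation that eliminates the multiplier
    \<open>l\<close>.\<close>
  have "(\<Sum>i\<in>UNIV. opt_path \<theta> $ i) = 1"
    using optimum_path_flow_in by (auto simp: path_flows_def)
  then have one: "l * s - (\<Sum>k\<in>UNIV. (\<Sum>j\<in>UNIV. M $ j $ k) * c $ k) = 1"
    unfolding zi sum_subtractf sum_distrib_left[symmetric] s_def sum_distrib_right
    by (subst (asm) sum.swap) simp
  \<comment> \<open>With \<open>?u = M *v ?one\<close>, the number \<open>s\<close> is twice the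
    congestion of \<open>A *v ?u\<close>. If it vanished, so would the flow, and the inverse
    identity would give \<open>?one = 0\<close>.\<close>
  have s: "s \<noteq> 0"
  proof
    assume "s = 0"
    let ?u = "M *v ?one"
    have X: "transpose A *v marginal_cost \<alpha> 0 (A *v ?u) = ?one"
      unfolding M_def by (rule M_matrix_right_inverse)
    have "?u \<bullet> ?one = s" by (simp add: s_def inner_vec_def matrix_vector_mult_def)
    with \<open>s = 0\<close> inner_marginal_cost_0[of ?u] have "A *v ?u = 0"
      unfolding X by (simp add: congestion_eq_0)
    with X have "?one = 0" by (simp add: marginal_cost_def vec_eq_iff matrix_vector_mult_def)
    then show False by (simp add: vec_eq_iff)
  qed
  have V: "V_coef M i k = ((\<Sum>j\<in>UNIV. M $ j $ k) * (\<Sum>k\<in>UNIV. M $ i $ k) - s * M $ i $ k) / s" for k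
    by (simp add: V_coef_def s_def sum_subtractf sum_distrib_left[symmetric] sum_distrib_right)
  \<comment> \<open>The rows of V sum to zero, so subtracting the constant \<open>c $ i\<close> from
    all entries of \<open>c\<close> changes nothing.\<close>
  have "(\<Sum>k\<in>UNIV. V_coef M i k) = 0"
    unfolding V sum_divide_distrib[symmetric] sum_subtractf sum_distrib_right[symmetric]
      sum_distrib_left[symmetric] s_def
    by (subst sum.swap) simp
  then have "(\<Sum>k\<in>UNIV. V_coef M i k * (c $ k - c $ i)) = (\<Sum>k\<in>UNIV. V_coef M i k * c $ k)"
    by (simp add: right_diff_distrib sum_subtractf sum_distrib_right[symmetric])
  also have "\<dots> = ((\<Sum>k\<in>UNIV. (\<Sum>j\<in>UNIV. M $ j $ k) * c $ k) * (\<Sum>k\<in>UNIV. M $ i $ k)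
      - s * (\<Sum>k\<in>UNIV. M $ i $ k * c $ k)) / s"
    unfolding V sum_divide_distrib[symmetric] times_divide_eq_left left_diff_distrib sum_subtractf
    by (simp add: sum_distrib_right sum_distrib_left mult_ac)
  also have "(\<Sum>k\<in>UNIV. (\<Sum>j\<in>UNIV. M $ j $ k) * c $ k) = l * s - 1" using one by simp
  finally show ?thesis
    unfolding zi W_coef_def s_def[symmetric] using s by (simp add: field_simps)
qed

end

section \<open>Random states\<close>

text \<open>The complement of the support is a union of null open sets; by Lindelof countably many
  of them already cover it.\<close>

lemma AE_law_support:
  fixes P :: "'a::second_countable_topology measure"
  assumes "\<And>U. open U \<Longrightarrow> U \<inter> space P \<in> sets P"
  shows "AE \<theta> in P. \<theta> \<in> law_support P"
proof -
  let ?N = "{U. open U \<and> emeasure P (U \<inter> space P) = 0}"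
  obtain \<U> where \<U>: "\<U> \<subseteq> ?N" "countable \<U>" "\<Union>\<U> = \<Union>?N"
    using Lindelof[of ?N] by auto
  have "AE \<theta> in P. \<forall>U\<in>\<U>. \<theta> \<notin> U"
  proof (subst AE_ball_countable[OF \<U>(2)], intro ballI)
    fix U assume "U \<in> \<U>"
    then have "U \<inter> space P \<in> null_sets P" using \<U>(1) assms by (auto simp: null_sets_def)
    from AE_not_in[OF this] show "AE \<theta> in P. \<theta> \<notin> U"
      using AE_space by eventually_elim auto
  qed
  then show ?thesis
    using AE_space
  proof eventually_elim
    case (elim \<theta>)
    then have "\<theta> \<notin> \<Union>?N" unfolding \<U>(3)[symmetric] by blast
    with elim show ?case by (auto simp: law_support_def zero_less_iff_neq_zero)
  qed
qed

lemma flow_cost_state_law: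
  assumes "\<Theta> \<in> \<Omega> \<rightarrow>\<^sub>M orthant_borel"
    and "(\<lambda>\<theta>. total_delay \<tau> \<theta> (f \<theta>)) \<in> borel_measurable orthant_borel"
  shows "flow_cost \<Omega> \<Theta> \<tau> f = (\<integral>\<theta>. total_delay \<tau> \<theta> (f \<theta>) \<partial>state_law \<Omega> \<Theta>)"
  unfolding flow_cost_def state_law_def using assms by (simp add: integral_distr)

lemma response_flow_eq: "response_flow A Ms \<pi> y \<theta> $ e =
    (\<Sum>m\<in>Ms. (\<Sum>\<gamma>\<in>UNIV. A $ e $ \<gamma> * y \<gamma> m) * \<pi> \<theta> m)"
  unfolding response_flow_def matrix_vector_mult_def
  by (simp add: sum_distrib_left sum_distrib_right mult.assoc) (rule sum.swap)

section \<open>Integrability of flows, costs and signals under the state law\<close>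

locale affine_state = affine_network A \<alpha> + prob_space P
  for A :: "real^'p::finite^'e::finite" and \<alpha> and P :: "(real^'e) measure" +
  assumes sets_P: "sets P = sets orthant_borel"
    and first_moment: "\<And>e. integrable P (\<lambda>\<theta>. \<theta> $ e)"
begin

abbreviation "delay \<equiv> affine_delay \<alpha>"

lemma space_P: "space P = orthant"
  using sets_eq_imp_space_eq[OF sets_P] by (simp add: space_restrict_space)

lemma measurable_P: "borel_measurable P = borel_measurable orthant_borel"
  using sets_P by (rule measurable_cong_sets) simp

text \<open>A common class for the optimum and all response flows. Constraints are imposed on the
  orthant only, as this is the whole space of \<open>P\<close>.\<close>

definition feasible :: "(real^'e \<Rightarrow> real^'e) \<Rightarrow> bool" where
  "feasible f \<longleftrightarrow> (\<forall>e. (\<lambda>\<theta>. f \<theta> $ e) \<in> borel_measurable P) \<and> (\<forall>\<theta>\<in>orthant. f \<theta> \<in> link_flows A)"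

lemma integrable_mult_bounded:
  fixes g h :: "real^'e \<Rightarrow> real"
  assumes "integrable P h" and "g \<in> borel_measurable P" and "\<And>\<theta>. \<theta> \<in> orthant \<Longrightarrow> \<bar>g \<theta>\<bar> \<le> K"
  shows "integrable P (\<lambda>\<theta>. g \<theta> * h \<theta>)"
proof (rule Bochner_Integration.integrable_bound)
  show "integrable P (\<lambda>\<theta>. K * h \<theta>)" using assms(1) by simp
  show "(\<lambda>\<theta>. g \<theta> * h \<theta>) \<in> borel_measurable P"
    by (rule borel_measurable_times[OF assms(2) borel_measurable_integrable[OF assms(1)]])
  show "AE \<theta> in P. norm (g \<theta> * h \<theta>) \<le> norm (K * h \<theta>)"
  proof (rule AE_I2)
    fix \<theta> assume "\<theta> \<in> space P"
    then have "\<bar>g \<theta>\<bar> \<le> \<bar>K\<bar>" using assms(3)[of \<theta>] by (auto simp: space_P)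
    then show "norm (g \<theta> * h \<theta>) \<le> norm (K * h \<theta>)" by (simp add: abs_mult mult_right_mono)
  qed
qed

lemma feasible_integrable_mult:
  fixes h :: "real^'e \<Rightarrow> real"
  assumes "feasible f" and "integrable P h"
  shows "integrable P (\<lambda>\<theta>. f \<theta> $ e * h \<theta>)"
proof -
  obtain K where "\<forall>x\<in>link_flows A. \<forall>e. \<bar>x $ e\<bar> \<le> K" using link_flows_bounded by blast
  with assms show ?thesis by (intro integrable_mult_bounded[where K = K]) (auto simp: feasible_def)
qed

text \<open>The capacity vector \<open>a\<close> is free because the Beckmann potential uses doubled
  capacities.\<close>

lemma feasible_integrable_delay:
  assumes "feasible f"
  shows "integrable P (\<lambda>\<theta>. link_delay a \<theta> (f \<theta>) $ e)"
  using feasible_integrable_mult[OF assms, of "\<lambda>_. 1" e] first_moment[of e]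
  by (simp add: link_delay_def)

lemma feasible_integrable_inner:
  assumes "feasible f" "feasible g"
  shows "integrable P (\<lambda>\<theta>. f \<theta> \<bullet> link_delay a \<theta> (g \<theta>))"
  unfolding inner_vec_def
  by (auto intro!: Bochner_Integration.integrable_sum feasible_integrable_mult
      feasible_integrable_delay assms)

lemma feasible_integrable_total_delay:
  "feasible f \<Longrightarrow> integrable P (\<lambda>\<theta>. total_delay (affine_delay a) \<theta> (f \<theta>))"
  unfolding total_delay_affine by (rule feasible_integrable_inner)

lemma feasible_integrable_path_cost:
  "feasible f \<Longrightarrow> integrable P (\<lambda>\<theta>. path_cost A delay \<gamma> \<theta> (f \<theta>))"
  using feasible_integrable_delay[of f \<alpha>]
  by (simp add: path_cost_def affine_delay_def link_delay_def)

lemma signaling_rule_bounds: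
  assumes "signaling_rule Ms \<pi>" "m \<in> Ms" "\<theta> \<in> orthant"
  shows "0 \<le> \<pi> \<theta> m" "\<pi> \<theta> m \<le> 1"
proof -
  show "0 \<le> \<pi> \<theta> m" using assms by (auto simp: signaling_rule_def)
  have "\<pi> \<theta> m \<le> (\<Sum>m\<in>Ms. \<pi> \<theta> m)"
    using assms by (intro member_le_sum) (auto simp: signaling_rule_def)
  then show "\<pi> \<theta> m \<le> 1" using assms by (auto simp: signaling_rule_def)
qed

lemma signaling_integrable_mult:
  fixes h :: "real^'e \<Rightarrow> real"
  assumes "signaling_rule Ms \<pi>" "m \<in> Ms" "integrable P h"
  shows "integrable P (\<lambda>\<theta>. h \<theta> * \<pi> \<theta> m)"
  unfolding mult.commute[of "h _"]
  using assms signaling_rule_bounds[OF assms(1,2)]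
  by (intro integrable_mult_bounded[where K = 1])
     (auto simp: signaling_rule_def measurable_P)

lemma response_path_flow:
  assumes "signaling_rule Ms \<pi>" "message_response Ms y" "\<theta> \<in> orthant"
  shows "(\<chi> \<gamma>. \<Sum>m\<in>Ms. y \<gamma> m * \<pi> \<theta> m) \<in> path_flows"
proof -
  have "(\<Sum>\<gamma>\<in>UNIV. \<Sum>m\<in>Ms. y \<gamma> m * \<pi> \<theta> m) = (\<Sum>m\<in>Ms. (\<Sum>\<gamma>\<in>UNIV. y \<gamma> m) * \<pi> \<theta> m)"
    unfolding sum_distrib_right by (rule sum.swap)
  also have "\<dots> = 1" using assms by (simp add: message_response_def signaling_rule_def)
  finally show ?thesis
    using assms by (auto simp: path_flows_def message_response_def signaling_rule_def
        intro!: sum_nonneg mult_nonneg_nonneg)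
qed

lemma feasible_response:
  assumes "signaling_rule Ms \<pi>" "message_response Ms y"
  shows "feasible (response_flow A Ms \<pi> y)"
  unfolding feasible_def
proof (intro conjI allI ballI)
  show "(\<lambda>\<theta>. response_flow A Ms \<pi> y \<theta> $ e) \<in> borel_measurable P" for e
    using assms(1) unfolding response_flow_eq measurable_P signaling_rule_def
    by (auto intro!: borel_measurable_sum borel_measurable_times)
  show "response_flow A Ms \<pi> y \<theta> \<in> link_flows A" if "\<theta> \<in> orthant" for \<theta>
    using response_path_flow[OF assms that] by (auto simp: response_flow_def link_flows_def)
qed

lemma feasible_optimum: "feasible opt"
proof -
  have "(\<lambda>\<theta>. opt \<theta> $ e) \<in> borel_measurable orthant_borel" for e
    by (intro measurable_restrict_space1 borel_measurable_continuous_onI continuous_intros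
        continuous_optimum_flow)
  then show ?thesis by (simp add: feasible_def optimum_flow_in measurable_P)
qed

text \<open>With delays frozen at the flow \<open>f\<close>, expected delay is linear in the
  response. Its coefficients are the message-weighted expected path costs that the equilibrium
  condition compares.\<close>

lemma integral_response_delay:
  assumes rule: "signaling_rule Ms \<pi>" and f: "feasible f"
  shows "(\<integral>\<theta>. response_flow A Ms \<pi> y \<theta> \<bullet> link_delay \<alpha> \<theta> (f \<theta>) \<partial>P)
    = (\<Sum>m\<in>Ms. \<Sum>\<gamma>\<in>UNIV. y \<gamma> m * (\<integral>\<theta>. path_cost A delay \<gamma> \<theta> (f \<theta>) * \<pi> \<theta> m \<partial>P))"
proof -
  have int: "integrable P (\<lambda>\<theta>. path_cost A delay \<gamma> \<theta> (f \<theta>) * \<pi> \<theta> m)" if "m \<in> Ms" for \<gamma> m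
    by (intro signaling_integrable_mult[OF rule that] feasible_integrable_path_cost f)
  have "response_flow A Ms \<pi> y \<theta> \<bullet> link_delay \<alpha> \<theta> (f \<theta>)
    = (\<Sum>\<gamma>\<in>UNIV. \<Sum>m\<in>Ms. y \<gamma> m * (path_cost A delay \<gamma> \<theta> (f \<theta>) * \<pi> \<theta> m))" for \<theta>
    unfolding response_flow_def inner_path_cost vec_lambda_beta sum_distrib_right
    by (simp only: mult_ac)
  also have "\<dots> \<theta> = (\<Sum>m\<in>Ms. \<Sum>\<gamma>\<in>UNIV. y \<gamma> m * (path_cost A delay \<gamma> \<theta> (f \<theta>) * \<pi> \<theta> m))" for \<theta>
    by (rule sum.swap)
  finally show ?thesis using int by (simp add: Bochner_Integration.integral_sum)
qed

section \<open>Existence and uniqueness of equilibria\<close>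

text \<open>Exposes the witness hidden in \<open>is_BWE\<close>, since the arguments below deviate
  in the response itself.\<close>

abbreviation equilibrium_response ::
    "'m set \<Rightarrow> (real^'e \<Rightarrow> 'm \<Rightarrow> real) \<Rightarrow> ('p \<Rightarrow> 'm \<Rightarrow> real) \<Rightarrow> bool" where
  "equilibrium_response Ms \<pi> y \<equiv> message_response Ms y \<and>
     (\<forall>i. \<forall>m\<in>Ms. y i m > 0 \<longrightarrow>
       (\<forall>j. (\<integral>\<theta>. (path_cost A delay i \<theta> (response_flow A Ms \<pi> y \<theta>)
         - path_cost A delay j \<theta> (response_flow A Ms \<pi> y \<theta>)) * \<pi> \<theta> m \<partial>P) \<le> 0))"

lemma is_BWE_iff:
  "is_BWE P A delay Ms \<pi> f \<longleftrightarrow> (\<exists>y. equilibrium_response Ms \<pi> y \<and> f = response_flow A Ms \<pi> y)"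
  unfolding is_BWE_def by blast

text \<open>For each message an equilibrium uses only cheapest paths, so with delays frozen at its
  flow no other response has a lower expected delay.\<close>

lemma equilibrium_variational:
  assumes rule: "signaling_rule Ms \<pi>" and y: "equilibrium_response Ms \<pi> y"
    and w: "message_response Ms w"
  shows "(\<integral>\<theta>. (response_flow A Ms \<pi> y \<theta> - response_flow A Ms \<pi> w \<theta>)
    \<bullet> link_delay \<alpha> \<theta> (response_flow A Ms \<pi> y \<theta>) \<partial>P) \<le> 0"
proof -
  let ?f = "response_flow A Ms \<pi> y"
  let ?c = "\<lambda>\<gamma> m. \<integral>\<theta>. path_cost A delay \<gamma> \<theta> (?f \<theta>) * \<pi> \<theta> m \<partial>P"
  have feas: "feasible ?f" "feasible (response_flow A Ms \<pi> w)"
    using rule y w by (auto intro: feasible_response)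
  have int: "integrable P (\<lambda>\<theta>. path_cost A delay \<gamma> \<theta> (?f \<theta>) * \<pi> \<theta> m)" if "m \<in> Ms" for \<gamma> m
    by (intro signaling_integrable_mult[OF rule that] feasible_integrable_path_cost feas)
  have le: "(\<Sum>\<gamma>\<in>UNIV. y \<gamma> m * ?c \<gamma> m) \<le> (\<Sum>\<gamma>\<in>UNIV. w \<gamma> m * ?c \<gamma> m)" if m: "m \<in> Ms" for m
  proof -
    have y_m: "\<And>\<gamma>. 0 \<le> y \<gamma> m" "(\<Sum>\<gamma>\<in>UNIV. y \<gamma> m) = 1"
      and w_m: "\<And>\<gamma>. 0 \<le> w \<gamma> m" "(\<Sum>\<gamma>\<in>UNIV. w \<gamma> m) = 1"
      using y w m by (auto simp: message_response_def)
    have best: "(\<Sum>\<gamma>\<in>UNIV. y \<gamma> m * ?c \<gamma> m) \<le> ?c j m" for j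
    proof -
      have "y \<gamma> m * ?c \<gamma> m \<le> y \<gamma> m * ?c j m" for \<gamma>
      proof (cases "y \<gamma> m > 0")
        case True
        then have "(\<integral>\<theta>. (path_cost A delay \<gamma> \<theta> (?f \<theta>) - path_cost A delay j \<theta> (?f \<theta>)) * \<pi> \<theta> m \<partial>P) \<le> 0"
          using y m by blast
        then have "?c \<gamma> m - ?c j m \<le> 0"
          unfolding left_diff_distrib Bochner_Integration.integral_diff[OF int[OF m] int[OF m]] .
        with True show ?thesis by (simp add: mult_left_mono)
      qed (use y_m(1)[of \<gamma>] in simp)
      then have "(\<Sum>\<gamma>\<in>UNIV. y \<gamma> m * ?c \<gamma> m) \<le> (\<Sum>\<gamma>\<in>UNIV. y \<gamma> m * ?c j m)" by (intro sum_mono)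
      also have "\<dots> = ?c j m" using y_m by (simp add: sum_distrib_right[symmetric])
      finally show ?thesis .
    qed
    have "(\<Sum>\<gamma>\<in>UNIV. y \<gamma> m * ?c \<gamma> m) = (\<Sum>j\<in>UNIV. w j m * (\<Sum>\<gamma>\<in>UNIV. y \<gamma> m * ?c \<gamma> m))"
      using w_m by (simp add: sum_distrib_right[symmetric])
    also have "\<dots> \<le> (\<Sum>j\<in>UNIV. w j m * ?c j m)"
      using w_m best by (intro sum_mono mult_left_mono) auto
    finally show ?thesis .
  qed
  have "(\<integral>\<theta>. (?f \<theta> - response_flow A Ms \<pi> w \<theta>) \<bullet> link_delay \<alpha> \<theta> (?f \<theta>) \<partial>P)
    = (\<Sum>m\<in>Ms. \<Sum>\<gamma>\<in>UNIV. y \<gamma> m * ?c \<gamma> m) - (\<Sum>m\<in>Ms. \<Sum>\<gamma>\<in>UNIV. w \<gamma> m * ?c \<gamma> m)"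
    using feas
    by (simp add: inner_diff_left feasible_integrable_inner integral_response_delay[OF rule])
  then show ?thesis using le by (simp add: sum_mono)
qed

lemma feasible_integrable_congestion:
  assumes "feasible f" "feasible g"
  shows "integrable P (\<lambda>\<theta>. congestion \<alpha> (f \<theta> - g \<theta>))"
proof -
  have "integrable P (\<lambda>\<theta>. (f \<theta> - g \<theta>) \<bullet> (link_delay \<alpha> \<theta> (f \<theta>) - link_delay \<alpha> \<theta> (g \<theta>)))"
    unfolding inner_diff
    using assms by (intro Bochner_Integration.integrable_diff feasible_integrable_inner)
  then show ?thesis by (simp only: link_delay_diff)
qed

text \<open>A nonnegative integrand whose integral is at most 0 vanishes almost everywhere, and the
  form is definite.\<close>

lemma congestion_integral_0:
  assumes "feasible f" "feasible g" and le: "(\<integral>\<theta>. congestion \<alpha> (f \<theta> - g \<theta>) \<partial>P) \<le> 0"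
  shows "AE \<theta> in P. f \<theta> = g \<theta>"
proof -
  note int = feasible_integrable_congestion[OF assms(1,2)]
  have "(\<integral>\<theta>. congestion \<alpha> (f \<theta> - g \<theta>) \<partial>P) = 0"
    using le by (intro antisym Bochner_Integration.integral_nonneg congestion_nonneg)
  with int have "AE \<theta> in P. congestion \<alpha> (f \<theta> - g \<theta>) = 0"
    by (subst (asm) integral_nonneg_eq_0_iff_AE) (auto simp: congestion_nonneg)
  then show ?thesis by (simp add: congestion_eq_0)
qed

text \<open>Each equilibrium is tested against the response of the other; adding the two
  inequalities makes the expected congestion of the difference nonpositive.\<close>

lemma BWE_unique:
  assumes rule: "signaling_rule Ms \<pi>"
    and f: "is_BWE P A delay Ms \<pi> f" and g: "is_BWE P A delay Ms \<pi> g"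
  shows "AE \<theta> in P. f \<theta> = g \<theta>"
proof -
  obtain y w where y: "equilibrium_response Ms \<pi> y" "f = response_flow A Ms \<pi> y"
    and w: "equilibrium_response Ms \<pi> w" "g = response_flow A Ms \<pi> w"
    using f g unfolding is_BWE_iff by blast
  have feas: "feasible f" "feasible g" using y w rule by (auto intro: feasible_response)
  have int: "integrable P (\<lambda>\<theta>. (f \<theta> - g \<theta>) \<bullet> link_delay \<alpha> \<theta> (f \<theta>))"
    "integrable P (\<lambda>\<theta>. (g \<theta> - f \<theta>) \<bullet> link_delay \<alpha> \<theta> (g \<theta>))"
    unfolding inner_diff_left
    by (intro Bochner_Integration.integrable_diff feasible_integrable_inner feas)+
  have "congestion \<alpha> (f \<theta> - g \<theta>) =
    (f \<theta> - g \<theta>) \<bullet> link_delay \<alpha> \<theta> (f \<theta>) + (g \<theta> - f \<theta>) \<bullet> link_delay \<alpha> \<theta> (g \<theta>)" for \<theta>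
    unfolding link_delay_diff[of _ _ _ \<theta>, symmetric] by (simp add: inner_diff)
  then have "(\<integral>\<theta>. congestion \<alpha> (f \<theta> - g \<theta>) \<partial>P) =
      (\<integral>\<theta>. (f \<theta> - g \<theta>) \<bullet> link_delay \<alpha> \<theta> (f \<theta>) \<partial>P) + (\<integral>\<theta>. (g \<theta> - f \<theta>) \<bullet> link_delay \<alpha> \<theta> (g \<theta>) \<partial>P)"
    using int by simp
  also have "\<dots> \<le> 0"
    using equilibrium_variational[OF rule y(1), of w] equilibrium_variational[OF rule w(1), of y] y w
    by simp
  finally show ?thesis by (rule congestion_integral_0[OF feas])
qed

text \<open>
  A minimiser of the expected Beckmann potential is an equilibrium response: shifting mass between two
  paths within one message cannot decrease it to first order.
\<close>

lemma potential_minimiser: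
  fixes Ms :: "'m set"
  assumes rule: "signaling_rule Ms \<pi>"
  defines "R \<equiv> \<lambda>u :: 'm \<Rightarrow> real^'p. response_flow A Ms \<pi> (\<lambda>\<gamma> m. u m $ \<gamma>)"
  defines "\<Phi> \<equiv> \<lambda>u. \<integral>\<theta>. total_delay (affine_delay (2 *\<^sub>R \<alpha>)) \<theta> (R u \<theta>) \<partial>P"
  shows "\<exists>u\<in>Pi\<^sub>E UNIV (\<lambda>_. path_flows). \<forall>w\<in>Pi\<^sub>E UNIV (\<lambda>_. path_flows). \<Phi> u \<le> \<Phi> w"
proof (rule continuous_attains_inf)
  \<comment> \<open>Every element of the message type gets a path flow, even outside
    \<open>Ms\<close>, so the domain is a full product of compact simplices and Tychonoff
    applies.\<close>
  have "compactin (product_topology (\<lambda>_::'m. euclidean) UNIV)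
      (Pi\<^sub>E UNIV (\<lambda>_. path_flows :: (real^'p) set))"
    by (simp add: compactin_PiE compact_path_flows)
  then show "compact (Pi\<^sub>E (UNIV :: 'm set) (\<lambda>_. path_flows :: (real^'p) set))"
    by (simp add: euclidean_product_topology)
  show "Pi\<^sub>E (UNIV :: 'm set) (\<lambda>_. path_flows :: (real^'p) set) \<noteq> {}"
    using axis_in_path_flows by (auto simp: PiE_eq_empty_iff)
  have coord: "R u \<theta> $ e = (\<Sum>m\<in>Ms. (A *v u m) $ e * \<pi> \<theta> m)" for u \<theta> e
    by (simp add: R_def response_flow_eq matrix_vector_mult_def)
  \<comment> \<open>Separating \<open>u\<close> from the state turns the expected potential into a
    polynomial in finitely many coordinates of \<open>u\<close>, which is continuous in the product
    topology.\<close>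
  have "total_delay (affine_delay (2 *\<^sub>R \<alpha>)) \<theta> (R u \<theta>) =
    (\<Sum>e\<in>UNIV. \<Sum>m\<in>Ms. (\<Sum>n\<in>Ms. (A *v u m) $ e * (A *v u n) $ e / (2 * \<alpha> $ e) * (\<pi> \<theta> m * \<pi> \<theta> n))
        + (A *v u m) $ e * (\<theta> $ e * \<pi> \<theta> m))" for u \<theta>
    unfolding total_delay_def affine_delay_def distrib_left coord
    by (rule sum.cong)
       (simp_all add: sum.distrib sum_distrib_right sum_distrib_left sum_divide_distrib mult_ac)
  moreover have "integrable P (\<lambda>\<theta>. \<pi> \<theta> m * \<pi> \<theta> n)" if "m \<in> Ms" "n \<in> Ms" for m n
    using signaling_integrable_mult[OF rule that(2) signaling_integrable_mult[OF rule that(1)],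
        of "\<lambda>_. 1"] by simp
  moreover have "integrable P (\<lambda>\<theta>. \<theta> $ e * \<pi> \<theta> m)" if "m \<in> Ms" for e m
    by (rule signaling_integrable_mult[OF rule that first_moment])
  ultimately have \<Phi>: "\<Phi> u = (\<Sum>e\<in>UNIV. \<Sum>m\<in>Ms.
      (\<Sum>n\<in>Ms. (A *v u m) $ e * (A *v u n) $ e / (2 * \<alpha> $ e) * (\<integral>\<theta>. \<pi> \<theta> m * \<pi> \<theta> n \<partial>P))
        + (A *v u m) $ e * (\<integral>\<theta>. \<theta> $ e * \<pi> \<theta> m \<partial>P))" for u
    unfolding \<Phi>_def by (simp add: Bochner_Integration.integral_sum)
  have "\<alpha> $ e \<noteq> 0" for e using alpha_pos[of e] by simp
  then show "continuous_on (Pi\<^sub>E UNIV (\<lambda>_. path_flows)) \<Phi>"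
    unfolding \<Phi> matrix_vector_mult_def
    by (auto intro!: continuous_intros continuous_on_component
        continuous_on_subset[OF continuous_on_product_coordinates])
qed

lemma BWE_exists:
  fixes Ms :: "'m set"
  assumes rule: "signaling_rule Ms \<pi>"
  shows "\<exists>f. is_BWE P A delay Ms \<pi> f"
proof -
  define R where "R = (\<lambda>u :: 'm \<Rightarrow> real^'p. response_flow A Ms \<pi> (\<lambda>\<gamma> m. u m $ \<gamma>))"
  define \<Phi> where "\<Phi> = (\<lambda>u. \<integral>\<theta>. total_delay (affine_delay (2 *\<^sub>R \<alpha>)) \<theta> (R u \<theta>) \<partial>P)"
  obtain u where u: "\<And>m. u m \<in> path_flows"
    and min: "\<And>w. (\<And>m. w m \<in> path_flows) \<Longrightarrow> \<Phi> u \<le> \<Phi> w"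
    using potential_minimiser[OF rule]
    unfolding PiE_UNIV_domain Bex_def Ball_def Pi_iff R_def \<Phi>_def by auto
  have resp: "message_response Ms (\<lambda>\<gamma> m. u m $ \<gamma>)"
    using u by (auto simp: message_response_def path_flows_def)
  have feas: "feasible (R u)" unfolding R_def by (rule feasible_response[OF rule resp])
  have "(\<integral>\<theta>. (path_cost A delay i \<theta> (R u \<theta>) - path_cost A delay j \<theta> (R u \<theta>)) * \<pi> \<theta> m \<partial>P) \<le> 0"
    if m: "m \<in> Ms" and pos: "0 < u m $ i" for i j m
  proof -
    let ?d = "axis j 1 - axis i 1 :: real^'p" and ?s = "u m $ i"
    \<comment> \<open>Slope of the potential per unit of mass moved from path \<open>i\<close> to
      path \<open>j\<close> within message \<open>m\<close>; it is the negative of the integral to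
      be bounded.\<close>
    let ?a = "\<integral>\<theta>. (A *v ?d) \<bullet> link_delay \<alpha> \<theta> (R u \<theta>) * \<pi> \<theta> m \<partial>P"
    let ?c = "\<integral>\<theta>. \<pi> \<theta> m * \<pi> \<theta> m \<partial>P"
    have inner: "(A *v ?d) \<bullet> link_delay \<alpha> \<theta> (R u \<theta>) =
        path_cost A delay j \<theta> (R u \<theta>) - path_cost A delay i \<theta> (R u \<theta>)" for \<theta>
      unfolding inner_matrix_vector path_cost_affine inner_diff_left inner_axis' by simp
    have int_a: "integrable P (\<lambda>\<theta>. (A *v ?d) \<bullet> link_delay \<alpha> \<theta> (R u \<theta>) * \<pi> \<theta> m)"
      unfolding inner
      by (intro signaling_integrable_mult[OF rule m] Bochner_Integration.integrable_diff
          feasible_integrable_path_cost feas)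
    have int_c: "integrable P (\<lambda>\<theta>. \<pi> \<theta> m * \<pi> \<theta> m)"
      using signaling_integrable_mult[OF rule m signaling_integrable_mult[OF rule m], of "\<lambda>_. 1"]
      by simp
    have "0 \<le> ?s * ?a"
    proof (rule slope_nonneg)
      fix t :: real assume t: "0 < t" "t \<le> 1"
      \<comment> \<open>A fraction \<open>t\<close> of the mass that message \<open>m\<close> puts
        on path \<open>i\<close> is moved to path \<open>j\<close>; other messages keep their path
        flows.\<close>
      define w where "w = u(m := u m + (t * ?s) *\<^sub>R ?d)"
      have w: "w n \<in> path_flows" for n
      proof -
        have "t * ?s \<le> ?s" "0 \<le> t * ?s" using t pos by auto
        then show ?thesis
          using u[of n] u[of m]
          by (auto simp: w_def path_flows_def axis_def sum.distrib sum_subtractf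
              sum_distrib_left[symmetric])
      qed
      have R_w: "R w \<theta> = R u \<theta> + (t * (?s * \<pi> \<theta> m)) *\<^sub>R (A *v ?d)" for \<theta>
      proof -
        have "(\<Sum>n\<in>Ms. w n $ \<gamma> * \<pi> \<theta> n)
            = (\<Sum>n\<in>Ms. u n $ \<gamma> * \<pi> \<theta> n + (if n = m then t * ?s * ?d $ \<gamma> * \<pi> \<theta> m else 0))" for \<gamma>
          by (rule sum.cong) (auto simp: w_def algebra_simps)
        also have "\<dots> \<gamma> = (\<Sum>n\<in>Ms. u n $ \<gamma> * \<pi> \<theta> n) + t * (?s * \<pi> \<theta> m) * ?d $ \<gamma>" for \<gamma>
          using m rule by (simp add: sum.distrib signaling_rule_def)
        finally have "(\<chi> \<gamma>. \<Sum>n\<in>Ms. w n $ \<gamma> * \<pi> \<theta> n)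
            = (\<chi> \<gamma>. \<Sum>n\<in>Ms. u n $ \<gamma> * \<pi> \<theta> n) + (t * (?s * \<pi> \<theta> m)) *\<^sub>R ?d"
          by (simp add: vec_eq_iff)
        then show ?thesis
          unfolding R_def response_flow_def
          by (simp only: matrix_vector_right_distrib matrix_vector_mult_scaleR)
      qed
      have "total_delay (affine_delay (2 *\<^sub>R \<alpha>)) \<theta> (R w \<theta>) =
          total_delay (affine_delay (2 *\<^sub>R \<alpha>)) \<theta> (R u \<theta>)
          + t * ?s * ((A *v ?d) \<bullet> link_delay \<alpha> \<theta> (R u \<theta>) * \<pi> \<theta> m)
          + t\<^sup>2 * ?s\<^sup>2 * congestion (2 *\<^sub>R \<alpha>) (A *v ?d) * (\<pi> \<theta> m * \<pi> \<theta> m)" for \<theta>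
        unfolding R_w total_delay_shift marginal_cost_double
        by (simp add: power2_eq_square mult_ac)
      then have "\<Phi> w = \<Phi> u + t * ?s * ?a + t\<^sup>2 * ?s\<^sup>2 * congestion (2 *\<^sub>R \<alpha>) (A *v ?d) * ?c"
        unfolding \<Phi>_def
        using int_a int_c feasible_integrable_total_delay[OF feas, of "2 *\<^sub>R \<alpha>"] by simp
      with min[of w] w
      show "0 \<le> t * (?s * ?a) + t\<^sup>2 * (?s\<^sup>2 * congestion (2 *\<^sub>R \<alpha>) (A *v ?d) * ?c)"
        by (simp add: mult_ac)
    qed
    with pos have "0 \<le> ?a" by (simp add: zero_le_mult_iff)
    moreover have "(\<integral>\<theta>. (path_cost A delay i \<theta> (R u \<theta>) - path_cost A delay j \<theta> (R u \<theta>)) * \<pi> \<theta> m \<partial>P)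
        = - ?a"
      unfolding inner Bochner_Integration.integral_minus[symmetric]
      by (simp only: minus_mult_left minus_diff_eq)
    ultimately show ?thesis by simp
  qed
  then have "equilibrium_response Ms \<pi> (\<lambda>\<gamma> m. u m $ \<gamma>)"
    using resp unfolding R_def by auto
  then show ?thesis unfolding is_BWE_iff by blast
qed

lemma BWE_flow: "signaling_rule Ms \<pi> \<Longrightarrow> is_BWE P A delay Ms \<pi> (BWE_flow P A delay Ms \<pi>)"
  unfolding BWE_flow_def by (rule someI_ex[OF BWE_exists])

lemma feasible_BWE:
  "signaling_rule Ms \<pi> \<Longrightarrow> is_BWE P A delay Ms \<pi> f \<Longrightarrow> feasible f"
  unfolding is_BWE_iff by (auto intro: feasible_response)

section \<open>Optimality of the direct rule\<close>

lemma optimum_cost_le: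
  assumes "feasible f"
  shows "(\<integral>\<theta>. total_delay delay \<theta> (opt \<theta>) \<partial>P) \<le> (\<integral>\<theta>. total_delay delay \<theta> (f \<theta>) \<partial>P)"
  using assms feasible_optimum
  by (intro integral_mono feasible_integrable_total_delay optimum_flow_le)
     (auto simp: feasible_def space_P)

text \<open>Integrating the pointwise gap bounds the expected congestion of
  \<open>f \<theta> - opt \<theta>\<close> by the excess cost, which is zero.\<close>

lemma optimum_cost_unique:
  assumes f: "feasible f"
    and eq: "(\<integral>\<theta>. total_delay delay \<theta> (f \<theta>) \<partial>P) = (\<integral>\<theta>. total_delay delay \<theta> (opt \<theta>) \<partial>P)"
  shows "AE \<theta> in P. f \<theta> = opt \<theta>"
proof (rule congestion_integral_0[OF f feasible_optimum])
  have "(\<integral>\<theta>. congestion \<alpha> (f \<theta> - opt \<theta>) \<partial>P)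
      \<le> (\<integral>\<theta>. total_delay delay \<theta> (f \<theta>) - total_delay delay \<theta> (opt \<theta>) \<partial>P)"
  proof (rule integral_mono)
    show "integrable P (\<lambda>\<theta>. congestion \<alpha> (f \<theta> - opt \<theta>))"
      by (rule feasible_integrable_congestion[OF f feasible_optimum])
  qed (use f in \<open>auto intro!: Bochner_Integration.integrable_diff feasible_integrable_total_delay
        feasible_optimum optimum_flow_gap simp: feasible_def space_P\<close>)
  also have "\<dots> = 0"
    using eq f feasible_optimum by (simp add: feasible_integrable_total_delay)
  finally show "(\<integral>\<theta>. congestion \<alpha> (f \<theta> - opt \<theta>) \<partial>P) \<le> 0" .
qed

lemma direct_rule_cost_iff:
  defines "\<pi> \<equiv> direct_optimum_rule A delay"
  shows "(\<integral>\<theta>. total_delay delay \<theta> (BWE_flow P A delay UNIV \<pi> \<theta>) \<partial>P)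
      = (\<integral>\<theta>. total_delay delay \<theta> (opt \<theta>) \<partial>P)
    \<longleftrightarrow> (\<forall>i j. (\<integral>\<theta>. (path_cost A delay i \<theta> (opt \<theta>) - path_cost A delay j \<theta> (opt \<theta>))
          * opt_path \<theta> $ i \<partial>P) \<le> 0)"
    (is "?eq \<longleftrightarrow> ?obedient")
proof -
  have rule: "signaling_rule UNIV \<pi>" unfolding \<pi>_def by (rule signaling_rule_optimum)
  let ?f = "BWE_flow P A delay UNIV \<pi>"
  have f: "is_BWE P A delay UNIV \<pi> ?f" by (rule BWE_flow[OF rule])
  note feas = feasible_BWE[OF rule f]
  show ?thesis
  proof
    assume ?obedient
    \<comment> \<open>The obedient response: each user takes the recommended path, which reproduces
      \<open>opt\<close>.\<close>
    let ?y = "\<lambda>(\<gamma> :: 'p) (m :: 'p). if \<gamma> = m then 1 else 0 :: real"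
    have opt: "response_flow A UNIV \<pi> ?y = opt"
      by (simp add: response_flow_def \<pi>_def direct_optimum_rule_def optimum_flow_eq fun_eq_iff
          if_distrib[of "\<lambda>x. x * _"] cong: if_cong)
    have eq: "equilibrium_response UNIV \<pi> ?y"
      unfolding opt
    proof (intro conjI allI ballI impI)
      show "message_response UNIV ?y" by (simp add: message_response_def)
      fix i m j assume "0 < ?y i m"
      then have "m = i" by (simp split: if_splits)
      then show "(\<integral>\<theta>. (path_cost A delay i \<theta> (opt \<theta>) - path_cost A delay j \<theta> (opt \<theta>)) * \<pi> \<theta> m \<partial>P) \<le> 0"
        using \<open>?obedient\<close> unfolding \<pi>_def direct_optimum_rule_def by blast
    qed
    have BWE: "is_BWE P A delay UNIV \<pi> opt"
      unfolding is_BWE_iff by (rule exI[of _ ?y], rule conjI[OF eq opt[symmetric]])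
    \<comment> \<open>\<open>BWE_flow\<close> may choose another equilibrium flow, but uniqueness
      makes it agree with \<open>opt\<close> almost everywhere.\<close>
    have "AE \<theta> in P. total_delay delay \<theta> (?f \<theta>) = total_delay delay \<theta> (opt \<theta>)"
      using BWE_unique[OF rule f BWE] by eventually_elim simp
    then show ?eq
      by (rule integral_cong_AE[rotated 2])
         (intro borel_measurable_integrable feasible_integrable_total_delay feas feasible_optimum)+
  next
    assume ?eq
    from optimum_cost_unique[OF feas this] have ae: "AE \<theta> in P. ?f \<theta> = opt \<theta>" .
    obtain y where y: "equilibrium_response UNIV \<pi> y" and f_y: "?f = response_flow A UNIV \<pi> y"
      using f unfolding is_BWE_iff by blast
    show ?obedient
    proof (intro allI)
      fix i j
      let ?D = "\<lambda>\<theta> x. path_cost A delay i \<theta> x - path_cost A delay j \<theta> x"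
      have int: "integrable P (\<lambda>\<theta>. ?D \<theta> (g \<theta>) * \<pi> \<theta> m)" if "feasible g" for g m
        using that
        by (intro signaling_integrable_mult[OF rule] Bochner_Integration.integrable_diff
            feasible_integrable_path_cost) auto
      text \<open>
        The response need not be the identity, but it reproduces the optimal path flow, so
        weighting the equilibrium conditions by it yields the conditions for obedience.
      \<close>
      have "AE \<theta> in P. (\<Sum>m\<in>UNIV. y i m * (?D \<theta> (?f \<theta>) * \<pi> \<theta> m)) = ?D \<theta> (opt \<theta>) * \<pi> \<theta> i"
        using ae
      proof eventually_elim
        case (elim \<theta>)
        \<comment> \<open>Injectivity of \<open>A\<close> lifts equality of link flows to equality
          of path flows.\<close>
        have "A *v (\<chi> \<gamma>. \<Sum>m\<in>UNIV. y \<gamma> m * \<pi> \<theta> m) = A *v opt_path \<theta>"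
          using elim unfolding f_y response_flow_def optimum_flow_eq .
        from injD[OF A_inj this] have sum: "(\<Sum>m\<in>UNIV. y i m * \<pi> \<theta> m) = \<pi> \<theta> i"
          by (simp add: vec_eq_iff \<pi>_def direct_optimum_rule_def)
        have "(\<Sum>m\<in>UNIV. y i m * (?D \<theta> (?f \<theta>) * \<pi> \<theta> m))
            = ?D \<theta> (opt \<theta>) * (\<Sum>m\<in>UNIV. y i m * \<pi> \<theta> m)"
          unfolding elim sum_distrib_left by (simp only: mult_ac)
        then show ?case by (simp only: sum)
      qed
      then have "(\<integral>\<theta>. ?D \<theta> (opt \<theta>) * \<pi> \<theta> i \<partial>P)
          = (\<integral>\<theta>. (\<Sum>m\<in>UNIV. y i m * (?D \<theta> (?f \<theta>) * \<pi> \<theta> m)) \<partial>P)"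
        using int[OF feas] int[OF feasible_optimum]
        by (intro integral_cong_AE borel_measurable_integrable Bochner_Integration.integrable_sum)
           (auto intro: integrable_mult_right)
      also have "\<dots> = (\<Sum>m\<in>UNIV. y i m * (\<integral>\<theta>. ?D \<theta> (?f \<theta>) * \<pi> \<theta> m \<partial>P))"
        using int[OF feas] by (simp add: Bochner_Integration.integral_sum)
      also have "\<dots> \<le> 0"
      proof (rule sum_nonpos)
        fix m
        have "0 \<le> y i m" using y by (auto simp: message_response_def)
        \<comment> \<open>The equilibrium inequality is available only where \<open>y i m\<close> is
          positive; terms of weight zero vanish.\<close>
        moreover have "(\<integral>\<theta>. ?D \<theta> (?f \<theta>) * \<pi> \<theta> m \<partial>P) \<le> 0" if "0 < y i m"
          using y that unfolding f_y by blast
        ultimately show "y i m * (\<integral>\<theta>. ?D \<theta> (?f \<theta>) * \<pi> \<theta> m \<partial>P) \<le> 0"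
          by (cases "y i m = 0") (auto intro: mult_nonneg_nonpos)
      qed
      finally show "(\<integral>\<theta>. ?D \<theta> (opt \<theta>) * opt_path \<theta> $ i \<partial>P) \<le> 0"
        by (simp add: \<pi>_def direct_optimum_rule_def)
    qed
  qed
qed

text \<open>The closed forms of the optimal path flow and of the cost differences hold on the
  support, which has full measure; the factor 2 undoes the half in the cost difference.\<close>

lemma obedience_integral:
  assumes interior: "\<And>\<theta> \<gamma>. \<theta> \<in> law_support P \<Longrightarrow> 0 < opt_path \<theta> $ \<gamma>"
  defines "M \<equiv> M_matrix A \<alpha>" and "b \<equiv> \<lambda>\<theta>. transpose A *v \<theta>"
  shows "(\<integral>\<theta>. (b \<theta> $ i - b \<theta> $ j)
      * (W_coef M i + (\<Sum>\<gamma>\<in>UNIV. V_coef M i \<gamma> * (b \<theta> $ \<gamma> - b \<theta> $ i))) \<partial>P)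
    = 2 * (\<integral>\<theta>. (path_cost A delay i \<theta> (opt \<theta>) - path_cost A delay j \<theta> (opt \<theta>))
          * opt_path \<theta> $ i \<partial>P)"
proof -
  have meas: "(\<lambda>\<theta>. b \<theta> $ k) \<in> borel_measurable P" for k
    unfolding b_def measurable_P
    by (intro measurable_restrict_space1 borel_measurable_continuous_onI continuous_intros)
  have "AE \<theta> in P. \<theta> \<in> law_support P"
    by (rule AE_law_support, unfold sets_P space_P sets_restrict_space, subst Int_commute)
       (intro imageI borel_open)
  then have "AE \<theta> in P. (b \<theta> $ i - b \<theta> $ j)
      * (W_coef M i + (\<Sum>\<gamma>\<in>UNIV. V_coef M i \<gamma> * (b \<theta> $ \<gamma> - b \<theta> $ i)))
    = 2 * ((path_cost A delay i \<theta> (opt \<theta>) - path_cost A delay j \<theta> (opt \<theta>)) * opt_path \<theta> $ i)"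
  proof eventually_elim
    case (elim \<theta>)
    show ?case
      unfolding interior_path_cost_diff[of \<theta>, OF interior[OF elim]] M_def b_def
        interior_optimum_path_flow[of \<theta>, OF interior[OF elim], symmetric] by simp
  qed
  moreover have "integrable P (\<lambda>\<theta>. (path_cost A delay i \<theta> (opt \<theta>) - path_cost A delay j \<theta> (opt \<theta>))
          * opt_path \<theta> $ i)"
    using signaling_integrable_mult[OF signaling_rule_optimum, of i]
    by (auto simp: direct_optimum_rule_def feasible_integrable_path_cost feasible_optimum)
  ultimately show ?thesis
    using meas by (subst integral_cong_AE) auto
qed

end

theorem theorem2:
  fixes \<sigma> \<xi> :: "'e::finite \<Rightarrow> 'v::finite"
    and orig dest :: 'v
    and route :: "'p::finite \<Rightarrow> 'e list"
    and A :: "real^'p^'e"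
    and \<alpha> :: "real^'e"
    and \<tau> :: "'e \<Rightarrow> real \<Rightarrow> real \<Rightarrow> real"
    and \<Omega> :: "'w measure"
    and \<Theta> :: "'w \<Rightarrow> real^'e"
    and b :: "'w \<Rightarrow> real^'p"
    and M :: "real^'p^'p"
  assumes no_self_loops: "\<And>e. \<sigma> e \<noteq> \<xi> e"
    and orig_dest: "orig \<noteq> dest"
    and paths: "enumerates_paths route \<sigma> \<xi> orig dest"
    and A_def: "A = incidence route"
    and A_inj: "inj (\<lambda>z. A *v z)"
    and prob: "prob_space \<Omega>"
    and Theta_rv: "\<Theta> \<in> \<Omega> \<rightarrow>\<^sub>M orthant_borel"
    and first_moment: "\<And>e. integrable \<Omega> (\<lambda>\<omega>. \<Theta> \<omega> $ e)"
    and second_moment: "\<And>e. integrable \<Omega> (\<lambda>\<omega>. (\<Theta> \<omega> $ e)\<^sup>2)"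
    and alpha_pos: "\<And>e. 0 < \<alpha> $ e"
    and tau_def: "\<tau> = affine_delay \<alpha>"
    and interior: "\<And>\<theta> \<gamma>. \<theta> \<in> law_support (state_law \<Omega> \<Theta>) \<Longrightarrow> 0 < optimum_path_flow A \<tau> \<theta> $ \<gamma>"
    and b_def: "\<And>\<omega>. b \<omega> = transpose A *v \<Theta> \<omega>"
    and M_def: "M = M_matrix A \<alpha>"
  shows "(optimal_rule \<Omega> \<Theta> A \<tau> UNIV (direct_optimum_rule A \<tau>)
          \<and> rule_cost \<Omega> \<Theta> A \<tau> UNIV (direct_optimum_rule A \<tau>)
              = flow_cost \<Omega> \<Theta> \<tau> (optimum_flow A \<tau>))
     \<longleftrightarrow> (\<forall>i j. prob_space.expectation \<Omega> (\<lambda>\<omega>. (b \<omega> $ i - b \<omega> $ j)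
            * (W_coef M i + (\<Sum>\<gamma>\<in>UNIV. V_coef M i \<gamma> * (b \<omega> $ \<gamma> - b \<omega> $ i)))) \<le> 0)"
proof -
  let ?P = "state_law \<Omega> \<Theta>"
  have continuous_measurable: "g \<in> borel_measurable orthant_borel" if "continuous_on UNIV g"
    for g :: "real^'e \<Rightarrow> real"
    using that by (intro measurable_restrict_space1 borel_measurable_continuous_onI)
  interpret affine_state A \<alpha> ?P
  proof (intro affine_state.intro affine_network.intro affine_state_axioms.intro A_inj alpha_pos)
    show "prob_space ?P"
      unfolding state_law_def by (rule prob_space.prob_space_distr[OF prob Theta_rv])
    show "sets ?P = sets orthant_borel" by (simp add: state_law_def)
    show "integrable ?P (\<lambda>\<theta>. \<theta> $ e)" for e
      unfolding state_law_def using first_moment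
      by (subst integrable_distr_eq[OF Theta_rv])
         (auto intro!: continuous_measurable continuous_intros)
  qed
  have cost: "flow_cost \<Omega> \<Theta> \<tau> f = (\<integral>\<theta>. total_delay \<tau> \<theta> (f \<theta>) \<partial>?P)" if "feasible f" for f
    using feasible_integrable_total_delay[OF that, of \<alpha>, THEN borel_measurable_integrable]
    by (intro flow_cost_state_law Theta_rv) (simp add: measurable_P tau_def)
  \<comment> \<open>The message type is generic here, so the bounds apply both to path
    recommendations and to the natural-number messages of competing rules.\<close>
  have rule_cost: "rule_cost \<Omega> \<Theta> A \<tau> Ms \<pi> = (\<integral>\<theta>. total_delay \<tau> \<theta> (BWE_flow ?P A \<tau> Ms \<pi> \<theta>) \<partial>?P)"
    "flow_cost \<Omega> \<Theta> \<tau> (optimum_flow A \<tau>) \<le> rule_cost \<Omega> \<Theta> A \<tau> Ms \<pi>"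
    if "signaling_rule Ms \<pi>" for Ms :: "'m set" and \<pi>
    using cost[OF feasible_BWE[OF that BWE_flow[OF that]]] cost[OF feasible_optimum]
      optimum_cost_le[OF feasible_BWE[OF that BWE_flow[OF that]]]
    by (simp_all add: rule_cost_def tau_def)
  let ?\<pi> = "direct_optimum_rule A \<tau>"
  have rule: "signaling_rule UNIV ?\<pi>" unfolding tau_def by (rule signaling_rule_optimum)
  \<comment> \<open>No rule costs less than the system optimum, so attaining that cost already
    implies optimality.\<close>
  have "(optimal_rule \<Omega> \<Theta> A \<tau> UNIV ?\<pi> \<and> rule_cost \<Omega> \<Theta> A \<tau> UNIV ?\<pi> = flow_cost \<Omega> \<Theta> \<tau> (optimum_flow A \<tau>))
    \<longleftrightarrow> rule_cost \<Omega> \<Theta> A \<tau> UNIV ?\<pi> = flow_cost \<Omega> \<Theta> \<tau> (optimum_flow A \<tau>)"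
    unfolding optimal_rule_def using rule rule_cost(2) by auto
  also have "\<dots> \<longleftrightarrow> (\<forall>i j. (\<integral>\<theta>. (path_cost A \<tau> i \<theta> (optimum_flow A \<tau> \<theta>)
      - path_cost A \<tau> j \<theta> (optimum_flow A \<tau> \<theta>)) * optimum_path_flow A \<tau> \<theta> $ i \<partial>?P) \<le> 0)"
    using direct_rule_cost_iff cost[OF feasible_optimum] rule_cost(1)[OF rule]
    unfolding tau_def by simp
  also have "\<dots> \<longleftrightarrow> (\<forall>i j. prob_space.expectation \<Omega> (\<lambda>\<omega>. (b \<omega> $ i - b \<omega> $ j)
            * (W_coef M i + (\<Sum>\<gamma>\<in>UNIV. V_coef M i \<gamma> * (b \<omega> $ \<gamma> - b \<omega> $ i)))) \<le> 0)"
  proof -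
    let ?b = "\<lambda>\<theta>. transpose A *v \<theta>"
    have "prob_space.expectation \<Omega> (\<lambda>\<omega>. (b \<omega> $ i - b \<omega> $ j)
            * (W_coef M i + (\<Sum>\<gamma>\<in>UNIV. V_coef M i \<gamma> * (b \<omega> $ \<gamma> - b \<omega> $ i))))
      = (\<integral>\<theta>. (?b \<theta> $ i - ?b \<theta> $ j)
            * (W_coef M i + (\<Sum>\<gamma>\<in>UNIV. V_coef M i \<gamma> * (?b \<theta> $ \<gamma> - ?b \<theta> $ i))) \<partial>?P)" for i j
      unfolding b_def state_law_def
      by (subst integral_distr[OF Theta_rv]) (intro continuous_measurable continuous_intros, rule refl)
    \<comment> \<open>The positive factor 2 leaves the sign unchanged.\<close>
    also have "\<dots> i j = 2 * (\<integral>\<theta>. (path_cost A \<tau> i \<theta> (optimum_flow A \<tau> \<theta>)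
      - path_cost A \<tau> j \<theta> (optimum_flow A \<tau> \<theta>)) * optimum_path_flow A \<tau> \<theta> $ i \<partial>?P)" for i j
      unfolding M_def tau_def using interior unfolding tau_def by (rule obedience_integral)
    finally show ?thesis by simp
  qed
  finally show ?thesis .
qed

end
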